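(* For any real numbers $s,t\ge0$ with $s+t=1$, the set $\mathrm{Bad}(s,t)\subset\mathbb{R}^2$ is $(24\sqrt{2})^{-1}$-winning for Schmidt's game.
   Context: For $z\in\mathbb{R}$, $\|z\|$ denotes the distance from $z$ to the nearest integer. For $s,t\ge0$ with $s+t=1$, a vector $(x,y)\in\mathbb{R}^2$ is $(s,t)$-badly approximable if $\inf_{q\in\mathbb{N}}\max\{q^s\|qx\|,q^t\|qy\|\}>0$; $\mathrm{Bad}(s,t)$ denotes the set of such vectors. Schmidt's game on $\mathbb{R}^2$ with parameters $\alpha,\beta\in(0,1)$: Bob chooses a closed disk $\mathcal{B}_0\subset\mathbb{R}^2$; after $\mathcal{B}_n$ is chosen, Alice chooses a closed disk $\mathcal{A}_n\subset\mathcal{B}_n$ with radius $\rho(\mathcal{A}_n)=\alpha\rho(\mathcal{B}_n)$, then Bob chooses a closed disk $\mathcal{B}_{n+1}\subset\mathcal{A}_n$ with $\rho(\mathcal{B}_{n+1})=\beta\rho(\mathcal{A}_n)$. A set $X\subset\mathbb{R}^2$ is $(\alpha,\beta)$-winning if Alice has a strategy guaranteeing that the unique point of $\bigcap_n\mathcal{A}_n$ lies in $X$, and $\alpha$-winning if it is $(\alpha,\beta)$-winning for every $\beta\in(0,1)$. *)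

theory Defs
  imports "HOL-Analysis.Analysis"
begin

definition dist_int :: "real \<Rightarrow> real" where
  "dist_int z = infdist z \<int>"

text \<open>Denominators are positive integers, so in the degenerate cases
  \<open>s = 0\<close> and \<open>t = 0\<close> the factor \<open>real q powr 0\<close> is \<open>1\<close>.\<close>

definition Bad :: "real \<Rightarrow> real \<Rightarrow> (real \<times> real) set" where
  "Bad s t = {(x, y).
     (INF q\<in>{q :: nat. q > 0}.
        max (real q powr s * dist_int (real q * x))
            (real q powr t * dist_int (real q * y))) > 0}"

text \<open>A closed disk is encoded by its centre and its positive radius, which the underlying set
  determines; the metric on \<^typ>\<open>real \<times> real\<close> is the Euclidean one.\<close>

type_synonym disk = "(real \<times> real) \<times> real"

abbreviation radius :: "disk \<Rightarrow> real" where
  "radius D \<equiv> snd D"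

definition disk_set :: "disk \<Rightarrow> (real \<times> real) set" where
  "disk_set D = cball (fst D) (radius D)"

text \<open>\<open>legal_move \<gamma> D E\<close>: after the disk \<open>D\<close>, a player whose parameter is \<open>\<gamma>\<close> may choose \<open>E\<close>.\<close>

definition legal_move :: "real \<Rightarrow> disk \<Rightarrow> disk \<Rightarrow> bool" where
  "legal_move \<gamma> D E \<longleftrightarrow> disk_set E \<subseteq> disk_set D \<and> radius E = \<gamma> * radius D"

text \<open>A strategy for Alice answers the finite list \<open>B\<^sub>0, \<dots>, B\<^sub>n\<close> of all disks that Bob has
  chosen so far; her own earlier disks are determined by it.\<close>

type_synonym strategy = "disk list \<Rightarrow> disk"

definition alice :: "strategy \<Rightarrow> (nat \<Rightarrow> disk) \<Rightarrow> nat \<Rightarrow> disk" where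
  "alice \<sigma> B n = \<sigma> (map B [0..<Suc n])"

text \<open>Bob's disks \<open>B\<^sub>0, \<dots>, B\<^sub>n\<close> obey the rules when Alice plays by \<open>\<sigma>\<close>.\<close>

definition bob_legal_upto :: "real \<Rightarrow> strategy \<Rightarrow> (nat \<Rightarrow> disk) \<Rightarrow> nat \<Rightarrow> bool" where
  "bob_legal_upto \<beta> \<sigma> B n \<longleftrightarrow>
     radius (B 0) > 0 \<and> (\<forall>k<n. legal_move \<beta> (alice \<sigma> B k) (B (Suc k)))"

text \<open>The first conjunct says that \<open>\<sigma>\<close> itself obeys the rules: it answers every legal finite
  sequence of Bob's disks by a legal disk.\<close>

definition game_winning :: "real \<Rightarrow> real \<Rightarrow> (real \<times> real) set \<Rightarrow> bool" where
  "game_winning \<alpha> \<beta> X \<longleftrightarrow>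
     (\<exists>\<sigma>. (\<forall>B n. bob_legal_upto \<beta> \<sigma> B n \<longrightarrow> legal_move \<alpha> (B n) (alice \<sigma> B n)) \<and>
          (\<forall>B. (\<forall>n. bob_legal_upto \<beta> \<sigma> B n) \<longrightarrow>
                 (\<exists>p\<in>X. (\<Inter>n. disk_set (alice \<sigma> B n)) = {p})))"

definition winning :: "real \<Rightarrow> (real \<times> real) set \<Rightarrow> bool" where
  "winning \<alpha> X \<longleftrightarrow> (\<forall>\<beta>\<in>{0<..<1}. game_winning \<alpha> \<beta> X)"

end

theory Submission
  imports Defs
begin

text \<open>Every rational point \<open>P = (p/q, r/q)\<close> lies on a line \<open>A x + B y + C = 0\<close> with
  \<open>\<bar>A\<bar> \<le> q\<^sup>s\<close> and \<open>\<bar>B\<bar> \<le> q\<^sup>t\<close>, and the forbidden box around \<open>P\<close> lies in a strip about that line whose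
  width is of the order of \<open>1 / H\<close>, where \<open>H = q max(\<bar>A\<bar>, \<bar>B\<bar>)\<close>. Sort the points by \<open>H\<close> and by the slack
  \<open>q\<^sup>\<sigma> / max(\<bar>A\<bar>, \<bar>B\<bar>)\<close>, \<open>\<sigma> = max(s, t)\<close>, in geometric scales indexed by \<open>m + k + 1\<close> and \<open>k\<close>. For a fixed disk
  of the \<open>m\<close>-th round the boxes of index \<open>(m, k)\<close> that meet it all lie in one strip: for \<open>k = 0\<close> because
  one line evaluated at another point, times its denominator, is an integer below 1 in modulus; for \<open>k > 0\<close>
  because two different lines would meet in a rational point of so small a denominator that its own box
  contains the whole disk, which is excluded by an earlier round.

  Alice therefore has to avoid, from round \<open>m\<close> on, strips whose widths decay geometrically in \<open>m + k\<close>. She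
  gives the strip \<open>(m, k)\<close> the weight \<open>(4/5)\<^sup>m\<^sup>+\<^sup>k\<^sup>+\<^sup>1\<close> and minimises the total weight of the strips
  meeting her disk over three disks at the corners of a right triangle. A thin strip misses at least one of
  them, so each of her moves multiplies the total weight by at most \<open>2/3\<close>, which beats the decay of the
  weights; hence every strip is left behind eventually.\<close>

section \<open>Rational points and integral lines\<close>

text \<open>For \<open>q > 0\<close> this is the closed box about (p/q, r/q) with half-sides
  \<epsilon> / q^(1+s) and \<epsilon> / q^(1+t). \<open>p\<close> and \<open>r\<close> range over
  all integers, so that no nearest integer has to be chosen.\<close>

definition approx_box :: "real \<Rightarrow> real \<Rightarrow> real \<Rightarrow> int \<Rightarrow> int \<Rightarrow> int \<Rightarrow> (real \<times> real) set" where
  "approx_box s t \<epsilon> q p r = {z. real_of_int q powr s * \<bar>q * fst z - p\<bar> \<le> \<epsilon> \<and>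
                         real_of_int q powr t * \<bar>q * snd z - r\<bar> \<le> \<epsilon>}"

definition coeff_norm :: "int \<Rightarrow> int \<Rightarrow> real" where
  "coeff_norm A B = max \<bar>real_of_int A\<bar> \<bar>real_of_int B\<bar>"

lemma coeff_norm_ge: "\<bar>real_of_int A\<bar> \<le> coeff_norm A B" "\<bar>real_of_int B\<bar> \<le> coeff_norm A B"
  by (auto simp: coeff_norm_def)

lemma coeff_norm_ge_1: "A \<noteq> 0 \<or> B \<noteq> 0 \<Longrightarrow> 1 \<le> coeff_norm A B"
  unfolding coeff_norm_def by linarith

text \<open>The point \<open>(p/q, r/q)\<close> on the line \<open>A x + B y + C = 0\<close>; the fractions need not be reduced.\<close>

definition flag :: "real \<Rightarrow> real \<Rightarrow> int \<Rightarrow> int \<Rightarrow> int \<Rightarrow> int \<Rightarrow> int \<Rightarrow> int \<Rightarrow> bool" where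
  "flag s t q p r A B C \<longleftrightarrow> q > 0 \<and> (A \<noteq> 0 \<or> B \<noteq> 0) \<and> A * p + B * r + C * q = 0 \<and>
     \<bar>real_of_int A\<bar> \<le> real_of_int q powr s \<and> \<bar>real_of_int B\<bar> \<le> real_of_int q powr t"

text \<open>Pigeonhole principle: since q^s q^t = q, there are more than q pairs (i, j) with 0 <= i
  <= floor(q^s) and 0 <= j <= floor(q^t), so i p + j r takes some residue modulo q twice. The
  difference of the two pairs gives \<open>A\<close> and \<open>B\<close>.\<close>

lemma flag_exists:
  assumes "q > 0" and st: "s + t = 1"
  shows "\<exists>A B C. flag s t q p r A B C"
proof -
  define a b where "a = \<lfloor>real_of_int q powr s\<rfloor>" and "b = \<lfloor>real_of_int q powr t\<rfloor>"
  define f where "f = (\<lambda>(i, j). (i * p + j * r) mod q)"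
  have ab0: "a \<ge> 0" "b \<ge> 0" by (auto simp: a_def b_def)
  have "real_of_int q = real_of_int q powr s * real_of_int q powr t"
    using assms by (simp flip: powr_add)
  also have "\<dots> < (real_of_int a + 1) * (real_of_int b + 1)"
    using assms unfolding a_def b_def
    by (intro mult_strict_mono) (linarith | simp add: add_nonneg_pos)+
  finally have "real_of_int q < real_of_int ((a + 1) * (b + 1))" by simp
  then have lt: "q < (a + 1) * (b + 1)" by linarith
  have "f ` ({0..a} \<times> {0..b}) \<subseteq> {0..<q}" using assms by (auto simp: f_def)
  from card_mono[OF _ this] have "card (f ` ({0..a} \<times> {0..b})) \<le> nat q" by simp
  also have "nat q < nat ((a + 1) * (b + 1))" using lt assms by simp
  also have "\<dots> = card ({0..a} \<times> {0..b})"
    using ab0 by (simp add: card_cartesian_product nat_mult_distrib)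
  finally have "\<not> inj_on f ({0..a} \<times> {0..b})" by (rule pigeonhole)
  then obtain i j i' j' where ij: "i \<in> {0..a}" "i' \<in> {0..a}" "j \<in> {0..b}" "j' \<in> {0..b}"
    "(i, j) \<noteq> (i', j')" "f (i, j) = f (i', j')"
    unfolding inj_on_def by (auto 4 3)
  from ij(6) have "q dvd (i * p + j * r) - (i' * p + j' * r)"
    by (simp add: f_def mod_eq_dvd_iff)
  then obtain c where c: "(i * p + j * r) - (i' * p + j' * r) = q * c" by (elim dvdE)
  have "\<bar>i - i'\<bar> \<le> a" "\<bar>j - j'\<bar> \<le> b" using ij by auto
  then have "\<bar>real_of_int (i - i')\<bar> \<le> a" "\<bar>real_of_int (j - j')\<bar> \<le> b" by linarith+
  moreover have "a \<le> real_of_int q powr s" "b \<le> real_of_int q powr t" by (auto simp: a_def b_def)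
  ultimately have "flag s t q p r (i - i') (j - j') (- c)"
    using ij(5) c assms(1) unfolding flag_def by (auto simp: algebra_simps)
  then show ?thesis by blast
qed

text \<open>As the line passes through (p/q, r/q), q (A x + B y + C) = A (q x - p) + B (q y - r),
  and each summand is at most \<epsilon> in modulus. The line may have been found for another point,
  as in \<open>collinear_base\<close>.\<close>

lemma line_bound:
  assumes "A * p + B * r + C * q = 0" and "q > 0"
    and "\<bar>real_of_int A\<bar> \<le> real_of_int q powr s" "\<bar>real_of_int B\<bar> \<le> real_of_int q powr t"
    and "z \<in> approx_box s t \<epsilon> q p r"
  shows "q * \<bar>A * fst z + B * snd z + C\<bar> \<le> 2 * \<epsilon>"
proof -
  have e: "real_of_int A * p + B * r + C * q = 0"
    using arg_cong[OF assms(1), of real_of_int] by simp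
  have "q * \<bar>A * fst z + B * snd z + C\<bar> = \<bar>q * (A * fst z + B * snd z + C)\<bar>"
    using assms(2) by (simp add: abs_mult)
  also have "\<dots> = \<bar>A * (q * fst z - p) + B * (q * snd z - r)\<bar>"
    using e by (simp add: algebra_simps)
  also have "\<dots> \<le> \<bar>real_of_int A\<bar> * \<bar>q * fst z - p\<bar> + \<bar>real_of_int B\<bar> * \<bar>q * snd z - r\<bar>"
    by (metis abs_mult abs_triangle_ineq)
  also have "\<dots> \<le> q powr s * \<bar>q * fst z - p\<bar> + q powr t * \<bar>q * snd z - r\<bar>"
    by (intro add_mono mult_right_mono assms) auto
  also have "\<dots> \<le> 2 * \<epsilon>" using assms(5) by (auto simp: approx_box_def)
  finally show ?thesis .
qed

text \<open>The value of the first line at the second point, times \<open>q2\<close>, is an integer,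
  and \<open>small\<close> forces it below 1 in modulus.\<close>

lemma flag_orthogonal:
  fixes L \<rho> \<epsilon> s t :: real
  assumes f1: "flag s t q1 p1 r1 A1 B1 C1" and "s \<ge> 0" "t \<ge> 0" "\<rho> \<ge> 0"
    and q: "q1 \<le> q2" "q2 \<le> L * q1"
    and u1: "u1 \<in> approx_box s t \<epsilon> q1 p1 r1" and u2: "u2 \<in> approx_box s t \<epsilon> q2 p2 r2"
    and d: "\<bar>fst u1 - fst u2\<bar> \<le> 2 * \<rho>" "\<bar>snd u1 - snd u2\<bar> \<le> 2 * \<rho>"
    and small: "L * (4 * \<rho> * (q1 * coeff_norm A1 B1) + 4 * \<epsilon>) < 1"
  shows "A1 * p2 + B1 * r2 + C1 * q2 = 0"
proof -
  define M where "M = coeff_norm A1 B1"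
  have q1: "q1 > 0" and "A1 * p1 + B1 * r1 + C1 * q1 = 0" using f1 by (auto simp: flag_def)
  from arg_cong[OF this(2), of real_of_int]
  have e1: "real_of_int A1 * p1 + B1 * r1 + C1 * q1 = 0" by simp
  have q2: "q2 > 0" using q q1 by simp
  have eps: "\<epsilon> \<ge> 0" using u1 unfolding approx_box_def
    by (smt (verit) mem_Collect_eq mult_nonneg_nonneg powr_ge_zero abs_ge_zero)
  have M: "\<bar>real_of_int A1\<bar> \<le> M" "\<bar>real_of_int B1\<bar> \<le> M" by (auto simp: M_def coeff_norm_ge)
  have L: "L \<ge> 1" using q q1 by (smt (verit) mult_le_cancel_right1 of_int_le_iff of_int_pos)
  \<comment> \<open>One estimate serves both coordinates, with (a, w) = (A1, s) and (B1, t). The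
    difference q1 y2 - q2 y1 is split into a displacement x2 - x1 and two approximation errors; q1
    <= q2 carries the bound on \<open>a\<close> over to q2^w.\<close>
  have aux: "\<bar>real_of_int a * (q1 * y2 - q2 * y1)\<bar> \<le> q1 * (L * (2 * \<rho> * (q1 * M) + 2 * \<epsilon>))"
    if a: "\<bar>real_of_int a\<bar> \<le> q1 powr w" "\<bar>real_of_int a\<bar> \<le> M" and w: "w \<ge> 0"
      and x: "\<bar>x1 - x2\<bar> \<le> 2 * \<rho>" "q1 powr w * \<bar>q1 * x1 - y1\<bar> \<le> \<epsilon>" "q2 powr w * \<bar>q2 * x2 - y2\<bar> \<le> \<epsilon>"
    for a :: int and w x1 x2 y1 y2 :: real
  proof -
    have "q1 powr w \<le> q2 powr w" using q q1 w by (intro powr_mono2) auto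
    then have a2: "\<bar>real_of_int a\<bar> \<le> q2 powr w" using a by simp
    have "\<bar>real_of_int a\<bar> * \<bar>q1 * x1 - y1\<bar> \<le> \<epsilon>"
      using mult_right_mono[OF a(1), of "\<bar>q1 * x1 - y1\<bar>"] x by simp
    then have b1: "q2 * (\<bar>real_of_int a\<bar> * \<bar>q1 * x1 - y1\<bar>) \<le> (L * q1) * \<epsilon>"
      using q q2 eps by (intro mult_mono) auto
    have "\<bar>real_of_int a\<bar> * \<bar>q2 * x2 - y2\<bar> \<le> \<epsilon>"
      using mult_right_mono[OF a2, of "\<bar>q2 * x2 - y2\<bar>"] x by simp
    then have b2: "q1 * (\<bar>real_of_int a\<bar> * \<bar>q2 * x2 - y2\<bar>) \<le> (L * q1) * \<epsilon>"
      using q q1 eps L by (intro mult_mono) auto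
    have b3: "(q1 * q2) * (\<bar>real_of_int a\<bar> * \<bar>x2 - x1\<bar>) \<le> (q1 * (L * q1)) * (M * (2 * \<rho>))"
      using q q1 q2 x a \<open>\<rho> \<ge> 0\<close> L by (intro mult_mono) (auto simp: abs_minus_commute)
    have "real_of_int a * (q1 * y2 - q2 * y1) = (q1 * q2) * (a * (x2 - x1))
         - q1 * (a * (q2 * x2 - y2)) + q2 * (a * (q1 * x1 - y1))" by (simp add: algebra_simps)
    also have "\<bar>\<dots>\<bar> \<le> \<bar>(q1 * q2) * (a * (x2 - x1))\<bar> + \<bar>q1 * (a * (q2 * x2 - y2))\<bar> + \<bar>q2 * (a * (q1 * x1 - y1))\<bar>"
      by linarith
    also have "\<dots> = (q1 * q2) * (\<bar>real_of_int a\<bar> * \<bar>x2 - x1\<bar>) + q1 * (\<bar>real_of_int a\<bar> * \<bar>q2 * x2 - y2\<bar>)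
         + q2 * (\<bar>real_of_int a\<bar> * \<bar>q1 * x1 - y1\<bar>)"
      using q1 q2 by (simp add: abs_mult)
    also have "\<dots> \<le> (q1 * (L * q1)) * (M * (2 * \<rho>)) + (L * q1) * \<epsilon> + (L * q1) * \<epsilon>"
      using b1 b2 b3 by linarith
    also have "\<dots> = q1 * (L * (2 * \<rho> * (q1 * M) + 2 * \<epsilon>))" by (simp add: algebra_simps)
    finally show ?thesis .
  qed
  have a: "\<bar>real_of_int A1\<bar> \<le> q1 powr s" "\<bar>real_of_int B1\<bar> \<le> q1 powr t"
    using f1 by (auto simp: flag_def)
  have "q1 * (real_of_int A1 * p2 + B1 * r2 + C1 * q2) =
      A1 * (q1 * p2 - q2 * p1) + B1 * (q1 * r2 - q2 * r1) + q2 * (real_of_int A1 * p1 + B1 * r1 + C1 * q1)"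
    by (simp add: algebra_simps)
  then have "q1 * (real_of_int A1 * p2 + B1 * r2 + C1 * q2) =
      A1 * (q1 * p2 - q2 * p1) + B1 * (q1 * r2 - q2 * r1)" using e1 by simp
  moreover have "\<bar>real_of_int A1 * (q1 * p2 - q2 * p1)\<bar> \<le> q1 * (L * (2 * \<rho> * (q1 * M) + 2 * \<epsilon>))"
    using aux[OF a(1) M(1) assms(2) d(1)] u1 u2 unfolding approx_box_def by simp
  moreover have "\<bar>real_of_int B1 * (q1 * r2 - q2 * r1)\<bar> \<le> q1 * (L * (2 * \<rho> * (q1 * M) + 2 * \<epsilon>))"
    using aux[OF a(2) M(2) assms(3) d(2)] u1 u2 unfolding approx_box_def by simp
  ultimately have "\<bar>q1 * (real_of_int A1 * p2 + B1 * r2 + C1 * q2)\<bar>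
      \<le> q1 * (L * (4 * \<rho> * (q1 * M) + 4 * \<epsilon>))" by (simp add: algebra_simps)
  also have "\<dots> < real_of_int q1 * 1"
    using small q1 unfolding M_def by (intro mult_strict_left_mono) simp_all
  finally have "\<bar>real_of_int A1 * p2 + B1 * r2 + C1 * q2\<bar> < 1"
    using q1 by (simp add: abs_mult)
  then have "\<bar>real_of_int (A1 * p2 + B1 * r2 + C1 * q2)\<bar> < 1" by simp
  then show ?thesis by linarith
qed

text \<open>For \<mu> >= 1 the factor q^\<sigma> only sharpens the comparison: q2 > \<mu> q1 would
  give q2^\<sigma> >= q1^\<sigma> and hence the reverse strict inequality.\<close>

lemma powr_ratio_le:
  fixes q1 q2 \<sigma> \<mu> :: real
  assumes "q1 > 0" "q2 > 0" "\<sigma> \<ge> 0" "\<mu> \<ge> 1"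
    and "q2 powr \<sigma> * q2 \<le> \<mu> * (q1 powr \<sigma> * q1)"
  shows "q2 \<le> \<mu> * q1"
proof (rule ccontr)
  assume "\<not> ?thesis"
  then have c: "q2 > \<mu> * q1" by simp
  have "q1 \<le> \<mu> * q1" using assms by simp
  then have "q1 \<le> q2" using c by linarith
  then have "q1 powr \<sigma> \<le> q2 powr \<sigma>" using assms by (intro powr_mono2) auto
  then have "q1 powr \<sigma> * (\<mu> * q1) < q2 powr \<sigma> * q2"
    using c assms by (intro mult_le_less_imp_less) auto
  then show False using assms(5) by (simp add: algebra_simps)
qed

text \<open>The cross product \<open>(D, B\<^sub>1 C\<^sub>2 - B\<^sub>2 C\<^sub>1, C\<^sub>1 A\<^sub>2 - C\<^sub>2 A\<^sub>1)\<close> of two integral lines is a rational point, and the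
  lemma bounds how well it approximates a point \<open>(x, y)\<close> close to both lines.\<close>

lemma line_intersection_bounds:
  fixes A1 B1 C1 A2 B2 C2 q1 q2 L W c x y s t :: real
  assumes st: "t \<le> s" "0 \<le> t" "s + t = 1" and q: "0 < q1" "q1 \<le> q2" "q2 \<le> L * q1"
    and W: "W \<ge> 1" "W\<^sup>2 \<le> q1 powr s"
    and A: "W\<^sup>2 * \<bar>A1\<bar> \<le> q1 powr s" "W\<^sup>2 * \<bar>A2\<bar> \<le> q2 powr s"
    and B: "\<bar>B1\<bar> \<le> q1 powr t" "\<bar>B2\<bar> \<le> q2 powr t"
    and c: "q1 * \<bar>A1 * x + B1 * y + C1\<bar> \<le> c" "q1 * \<bar>A2 * x + B2 * y + C2\<bar> \<le> c"
  defines "D \<equiv> A1 * B2 - A2 * B1"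
  shows "\<bar>D\<bar> powr s * \<bar>D * x - (B1 * C2 - B2 * C1)\<bar> \<le> 4 * L ^ 3 * c / W"
    and "\<bar>D\<bar> powr t * \<bar>D * y - (C1 * A2 - C2 * A1)\<bar> \<le> 4 * L ^ 3 * c / W"
    and "\<bar>D * x - (B1 * C2 - B2 * C1)\<bar> \<le> 2 * L * c / W\<^sup>2"
    and "\<bar>D * y - (C1 * A2 - C2 * A1)\<bar> \<le> 2 * L * c / W\<^sup>2"
proof -
  define S U where "S = q1 powr s" and "U = q1 powr t"
  have SU: "S * U = q1" "S > 0" "U > 0"
    using st q by (auto simp: S_def U_def simp flip: powr_add)
  have c0: "c \<ge> 0" using c(1) q by (smt (verit) mult_nonneg_nonneg abs_ge_zero)
  have L: "L \<ge> 1" using q by (smt (verit) mult_le_cancel_right1)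
  \<comment> \<open>As L >= 1, L^w may be rounded up to L; from here on every power of
    \<open>q2\<close> is measured by one of \<open>q1\<close>.\<close>
  have powL: "q2 powr w \<le> L * q1 powr w" if "0 \<le> w" "w \<le> 1" for w
  proof -
    have "q2 powr w \<le> (L * q1) powr w" using that q by (intro powr_mono2) auto
    also have "\<dots> = L powr w * q1 powr w" using q L by (simp add: powr_mult)
    also have "L powr w \<le> L powr 1" using that L by (intro powr_mono) auto
    finally show ?thesis using L by (simp add: mult_right_mono)
  qed
  define a b where "a = L * S / W\<^sup>2" and "b = L * U"
  have ab0: "a \<ge> 0" "b \<ge> 0" using L SU by (auto simp: a_def b_def)
  have S2: "q2 powr s \<le> L * S" "q1 powr s \<le> L * S" using powL[of s] st L SU by (auto simp: S_def)
  have U2: "q2 powr t \<le> L * U" "q1 powr t \<le> L * U" using powL[of t] st L SU by (auto simp: U_def)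
  have a: "\<bar>A1\<bar> \<le> a" "\<bar>A2\<bar> \<le> a" using A S2 W unfolding a_def
    by (auto simp: field_simps)
  have b: "\<bar>B1\<bar> \<le> b" "\<bar>B2\<bar> \<le> b" using B U2 unfolding b_def by auto
  have f: "\<bar>A1 * x + B1 * y + C1\<bar> \<le> c / q1" "\<bar>A2 * x + B2 * y + C2\<bar> \<le> c / q1"
    using c q by (auto simp: field_simps)
  \<comment> \<open>Eliminating y from the two line forms leaves D x minus the first numerator;
    eliminating x below treats the second coordinate.\<close>
  have "\<bar>D * x - (B1 * C2 - B2 * C1)\<bar> = \<bar>B2 * (A1 * x + B1 * y + C1) - B1 * (A2 * x + B2 * y + C2)\<bar>"
    by (simp add: D_def algebra_simps)
  also have "\<dots> \<le> \<bar>B2\<bar> * \<bar>A1 * x + B1 * y + C1\<bar> + \<bar>B1\<bar> * \<bar>A2 * x + B2 * y + C2\<bar>"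
    by (metis abs_mult abs_triangle_ineq4)
  also have "\<dots> \<le> b * (c / q1) + b * (c / q1)" using b f ab0 by (intro add_mono mult_mono) auto
  also have "\<dots> = 2 * L * c / S" using SU q by (simp add: b_def field_simps)
  finally have X: "\<bar>D * x - (B1 * C2 - B2 * C1)\<bar> \<le> 2 * L * c / S" .
  have "\<bar>D * y - (C1 * A2 - C2 * A1)\<bar> = \<bar>A1 * (A2 * x + B2 * y + C2) - A2 * (A1 * x + B1 * y + C1)\<bar>"
    by (simp add: D_def algebra_simps)
  also have "\<dots> \<le> \<bar>A1\<bar> * \<bar>A2 * x + B2 * y + C2\<bar> + \<bar>A2\<bar> * \<bar>A1 * x + B1 * y + C1\<bar>"
    by (metis abs_mult abs_triangle_ineq4)
  also have "\<dots> \<le> a * (c / q1) + a * (c / q1)" using a f ab0 by (intro add_mono mult_mono) auto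
  also have "\<dots> = 2 * L * c / (W\<^sup>2 * U)" using SU q W by (simp add: a_def field_simps)
  finally have Y: "\<bar>D * y - (C1 * A2 - C2 * A1)\<bar> \<le> 2 * L * c / (W\<^sup>2 * U)" .
  have "U \<ge> 1"
  proof -
    have "1 \<le> q1 powr s" using W by (smt (verit) one_le_power)
    moreover have "q1 powr s < 1 powr s" if "q1 < 1"
      using that q st by (intro powr_less_mono2) auto
    ultimately have "q1 \<ge> 1" by force
    then show ?thesis using st by (simp add: U_def ge_one_powr_ge_zero)
  qed
  have "2 * L * c / S \<le> 2 * L * c / W\<^sup>2" using W SU L c0 by (intro divide_left_mono) (auto simp: S_def)
  with X show "\<bar>D * x - (B1 * C2 - B2 * C1)\<bar> \<le> 2 * L * c / W\<^sup>2" by linarith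
  have "2 * L * c / (W\<^sup>2 * U) \<le> 2 * L * c / W\<^sup>2"
    using W SU L c0 \<open>U \<ge> 1\<close> by (intro divide_left_mono) auto
  with Y show "\<bar>D * y - (C1 * A2 - C2 * A1)\<bar> \<le> 2 * L * c / W\<^sup>2" by linarith
  have "\<bar>D\<bar> \<le> \<bar>A1\<bar> * \<bar>B2\<bar> + \<bar>A2\<bar> * \<bar>B1\<bar>"
    unfolding D_def by (metis abs_mult abs_triangle_ineq4)
  also have "\<dots> \<le> a * b + a * b" using a b ab0 by (intro add_mono mult_mono) auto
  also have "\<dots> = 2 * L\<^sup>2 / W\<^sup>2 * q1" using SU by (simp add: a_def b_def power2_eq_square)
  finally have D: "\<bar>D\<bar> \<le> 2 * L\<^sup>2 / W\<^sup>2 * q1" .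
  have Dw: "\<bar>D\<bar> powr w \<le> 2 * L\<^sup>2 * q1 powr w / W powr (2 * w)" if "0 \<le> w" "w \<le> 1" for w
  proof -
    have "\<bar>D\<bar> powr w \<le> (2 * L\<^sup>2 / W\<^sup>2 * q1) powr w" using that D by (intro powr_mono2) auto
    also have "\<dots> = (2 * L\<^sup>2) powr w / (W\<^sup>2) powr w * q1 powr w"
      using q L W by (simp add: powr_mult powr_divide)
    also have "(W\<^sup>2) powr w = W powr (2 * w)" using W by (simp add: powr_powr flip: powr_numeral)
    also have "(2 * L\<^sup>2) powr w / W powr (2 * w) * q1 powr w \<le> (2 * L\<^sup>2) powr 1 / W powr (2 * w) * q1 powr w"
    proof -
      have "1 \<le> 2 * L\<^sup>2" using one_le_power[OF L, of 2] by simp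
      then show ?thesis using that W
        by (intro mult_right_mono divide_right_mono powr_mono) auto
    qed
    finally show ?thesis using L by simp
  qed
  have "\<bar>D\<bar> powr s * \<bar>D * x - (B1 * C2 - B2 * C1)\<bar> \<le> (2 * L\<^sup>2 * S / W) * (2 * L * c / S)"
  proof (intro mult_mono X)
    \<comment> \<open>From t <= s and s + t = 1 follows 2 s >= 1. This is the source of the gain 1 /
      W, since the bound \<open>X\<close> contains no power of \<open>W\<close>.\<close>
    have "W powr 1 \<le> W powr (2 * s)" using W st by (intro powr_mono) auto
    then have "2 * L\<^sup>2 * S / W powr (2 * s) \<le> 2 * L\<^sup>2 * S / W"
      using W L SU by (intro divide_left_mono) auto
    then show "\<bar>D\<bar> powr s \<le> 2 * L\<^sup>2 * S / W" using Dw[of s] st by (auto simp: S_def)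
  qed (use L SU W in auto)
  also have "\<dots> = 4 * L ^ 3 * c / W" using SU by (simp add: power2_eq_square power3_eq_cube)
  finally show "\<bar>D\<bar> powr s * \<bar>D * x - (B1 * C2 - B2 * C1)\<bar> \<le> 4 * L ^ 3 * c / W" .
  have "\<bar>D\<bar> powr t * \<bar>D * y - (C1 * A2 - C2 * A1)\<bar> \<le> (2 * L\<^sup>2 * U) * (2 * L * c / (W\<^sup>2 * U))"
  proof (intro mult_mono Y)
    \<comment> \<open>As \<open>t\<close> may be 0, the power of D need not gain anything here; the
      bound \<open>Y\<close> already contains W^2.\<close>
    have "W powr 0 \<le> W powr (2 * t)" using W st by (intro powr_mono) auto
    then have "2 * L\<^sup>2 * U / W powr (2 * t) \<le> 2 * L\<^sup>2 * U / 1"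
      using W L SU by (intro divide_left_mono) auto
    then show "\<bar>D\<bar> powr t \<le> 2 * L\<^sup>2 * U" using Dw[of t] st by (auto simp: U_def)
  qed (use L SU W in auto)
  also have "\<dots> = 4 * L ^ 3 * c / W\<^sup>2" using SU by (simp add: power2_eq_square power3_eq_cube)
  also have "\<dots> \<le> 4 * L ^ 3 * c / W"
    using W L c0 by (intro divide_left_mono) (auto simp: power2_eq_square)
  finally show "\<bar>D\<bar> powr t * \<bar>D * y - (C1 * A2 - C2 * A1)\<bar> \<le> 4 * L ^ 3 * c / W" .
qed

text \<open>\<open>h\<close> and \<open>R h\<close> enclose the height \<open>q max(\<bar>A\<bar>, \<bar>B\<bar>)\<close>; \<open>u\<close> and \<open>v\<close> enclose the slack.\<close>

definition graded :: "real \<Rightarrow> real \<Rightarrow> real \<Rightarrow> real \<Rightarrow> real \<Rightarrow> real \<Rightarrow> int \<Rightarrow> int \<Rightarrow> int \<Rightarrow> bool" where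
  "graded s t R h u v q A B \<longleftrightarrow>
     h \<le> q * coeff_norm A B \<and> q * coeff_norm A B < R * h \<and>
     u * coeff_norm A B \<le> q powr max s t \<and> q powr max s t < v * coeff_norm A B"

text \<open>Multiplying the enclosures of height and slack confines q^(1+\<sigma>) to the range from
  u h to v R h, so within a class it varies by a factor of at most v R / u, and then so does
  q.\<close>

lemma graded_ratio:
  assumes g1: "graded s t R h u v q1 A1 B1" and g2: "graded s t R h u v q2 A2 B2"
    and pos: "q1 > 0" "q2 > 0" "u > 0" "v \<ge> u" "R \<ge> 1" "h > 0" "s \<ge> 0"
  shows "q2 \<le> v / u * R * q1"
proof -
  define M1 M2 where "M1 = coeff_norm A1 B1" and "M2 = coeff_norm A2 B2"
  define \<sigma> where "\<sigma> = max s t"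
  have h: "h \<le> q1 * M1" "q2 * M2 \<le> R * h" "u * M1 \<le> q1 powr \<sigma>" "q2 powr \<sigma> \<le> v * M2"
    using g1 g2 unfolding graded_def M1_def M2_def \<sigma>_def by (blast intro: less_imp_le)+
  have v: "v > 0" using pos(3,4) by linarith
  then have vu: "v / u * R > 0" using pos(3,5) by (intro mult_pos_pos divide_pos_pos) linarith+
  have "q2 powr \<sigma> * q2 \<le> (v * M2) * q2"
    by (rule mult_right_mono[OF h(4)]) (use pos(2) in simp)
  also have "\<dots> = v * (q2 * M2)" by (simp only: ac_simps)
  also have "\<dots> \<le> v * (R * h)" by (rule mult_left_mono[OF h(2)]) (use v in linarith)
  also have "\<dots> \<le> v * (R * (q1 * M1))"
    by (intro mult_left_mono h(1)) (use pos(5) v in linarith)+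
  also have "\<dots> = (v / u * R) * ((u * M1) * q1)" using pos(3) by (simp add: field_simps)
  also have "\<dots> \<le> (v / u * R) * (q1 powr \<sigma> * q1)"
    by (intro mult_left_mono mult_right_mono h(3)) (use pos(1) vu in simp_all)
  finally have r: "q2 powr \<sigma> * q2 \<le> (v / u * R) * (q1 powr \<sigma> * q1)" .
  have "1 \<le> v / u" using pos(3,4) by simp
  then have "1 * 1 \<le> v / u * R" using pos(5) by (intro mult_mono) simp_all
  then have "1 \<le> v / u * R" by (simp only: mult_1)
  moreover have "\<sigma> \<ge> 0" unfolding \<sigma>_def using pos(7) by linarith
  ultimately show ?thesis using pos(1,2) r by (intro powr_ratio_le[of q1 q2 \<sigma> "v / u * R"]) (simp_all only: of_int_0_less_iff)
qed

text \<open>\<open>flag_orthogonal\<close> puts the second point on the first line. As q1 <= q2, the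
  coefficients of that line also obey the size bounds for \<open>q2\<close>, so
  \<open>line_bound\<close> applies to it on the second box.\<close>

lemma collinear_base:
  fixes \<epsilon> h R v \<rho> s t :: real
  assumes st: "s \<ge> 0" "t \<ge> 0"
    and f1: "flag s t q1 p1 r1 A1 B1 C1" and f2: "flag s t q2 p2 r2 A2 B2 C2"
    and g1: "graded s t R h 1 v q1 A1 B1" and g2: "graded s t R h 1 v q2 A2 B2"
    and q: "q1 \<le> q2" and pos: "R \<ge> 1" "h > 0" "v \<ge> 1" "\<rho> \<ge> 0"
    and u1: "u1 \<in> approx_box s t \<epsilon> q1 p1 r1" and u2: "u2 \<in> approx_box s t \<epsilon> q2 p2 r2"
    and d: "\<bar>fst u1 - fst u2\<bar> \<le> 2 * \<rho>" "\<bar>snd u1 - snd u2\<bar> \<le> 2 * \<rho>"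
    and small: "v * R * (4 * \<rho> * (R * h) + 4 * \<epsilon>) < 1"
    and z: "z \<in> approx_box s t \<epsilon> q2 p2 r2"
  shows "h * \<bar>A1 * fst z + B1 * snd z + C1\<bar> \<le> 2 * \<epsilon> * coeff_norm A1 B1"
proof -
  have q0: "q1 > 0" "q2 > 0" using f1 f2 by (auto simp: flag_def)
  have L: "q2 \<le> v * R * q1" using graded_ratio[OF g1 g2] q0 pos st by simp
  have "v * R * (4 * \<rho> * (q1 * coeff_norm A1 B1) + 4 * \<epsilon>) \<le> v * R * (4 * \<rho> * (R * h) + 4 * \<epsilon>)"
    using g1 pos unfolding graded_def
    by (intro mult_left_mono add_mono) simp_all
  then have o: "A1 * p2 + B1 * r2 + C1 * q2 = 0"
    using small pos by (intro flag_orthogonal[OF f1 st _ q L u1 u2 d]) linarith+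
  have "q1 powr s \<le> q2 powr s" "q1 powr t \<le> q2 powr t"
    using q q0 st by (auto intro!: powr_mono2)
  then have "\<bar>real_of_int A1\<bar> \<le> q2 powr s" "\<bar>real_of_int B1\<bar> \<le> q2 powr t"
    using f1 by (auto simp: flag_def)
  from line_bound[OF o q0(2) this z]
  have "q2 * \<bar>A1 * fst z + B1 * snd z + C1\<bar> \<le> 2 * \<epsilon>" .
  moreover have "q1 * \<bar>A1 * fst z + B1 * snd z + C1\<bar> \<le> q2 * \<bar>A1 * fst z + B1 * snd z + C1\<bar>"
    using q by (intro mult_right_mono) auto
  ultimately have b: "q1 * \<bar>A1 * fst z + B1 * snd z + C1\<bar> \<le> 2 * \<epsilon>" by linarith
  have "h * \<bar>A1 * fst z + B1 * snd z + C1\<bar> \<le> (q1 * coeff_norm A1 B1) * \<bar>A1 * fst z + B1 * snd z + C1\<bar>"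
    using g1 by (intro mult_right_mono) (auto simp: graded_def)
  also have "\<dots> = (q1 * \<bar>A1 * fst z + B1 * snd z + C1\<bar>) * coeff_norm A1 B1" by simp
  also have "\<dots> \<le> 2 * \<epsilon> * coeff_norm A1 B1"
    using b by (intro mult_right_mono) (auto simp: coeff_norm_def)
  finally show ?thesis .
qed

text \<open>Moving from \<open>w\<close> to \<open>z\<close> changes the line form by at most 4
  \<rho> times the coefficient norm, and q times this norm is less than R h.\<close>

lemma line_near_disk:
  fixes \<epsilon> h R \<rho> s t :: real
  assumes f: "flag s t q p r A B C" and g: "graded s t R h u v q A B"
    and u: "w \<in> approx_box s t \<epsilon> q p r" and "\<rho> \<ge> 0"
    and d: "\<bar>fst z - fst w\<bar> \<le> 2 * \<rho>" "\<bar>snd z - snd w\<bar> \<le> 2 * \<rho>"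
  shows "q * \<bar>A * fst z + B * snd z + C\<bar> \<le> 4 * \<rho> * (R * h) + 2 * \<epsilon>"
proof -
  define M where "M = coeff_norm A B"
  have M: "\<bar>real_of_int A\<bar> \<le> M" "\<bar>real_of_int B\<bar> \<le> M" by (auto simp: M_def coeff_norm_ge)
  have q0: "q > 0" using f by (auto simp: flag_def)
  have "A * fst z + B * snd z + C = A * (fst z - fst w) + B * (snd z - snd w) + (A * fst w + B * snd w + C)"
    by (simp add: algebra_simps)
  also have "\<bar>\<dots>\<bar> \<le> \<bar>real_of_int A\<bar> * \<bar>fst z - fst w\<bar> + \<bar>real_of_int B\<bar> * \<bar>snd z - snd w\<bar> + \<bar>A * fst w + B * snd w + C\<bar>"
    unfolding abs_mult[symmetric] by linarith
  also have "\<dots> \<le> M * (2 * \<rho>) + M * (2 * \<rho>) + \<bar>A * fst w + B * snd w + C\<bar>"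
    using M d assms by (intro add_mono mult_mono) auto
  finally have "q * \<bar>A * fst z + B * snd z + C\<bar> \<le> q * (M * (2 * \<rho>) + M * (2 * \<rho>) + \<bar>A * fst w + B * snd w + C\<bar>)"
    using q0 by (intro mult_left_mono) auto
  also have "\<dots> = 4 * \<rho> * (q * M) + q * \<bar>A * fst w + B * snd w + C\<bar>" by (simp add: algebra_simps)
  also have "\<dots> \<le> 4 * \<rho> * (R * h) + 2 * \<epsilon>"
    using g line_bound[of A p B r C q s t w \<epsilon>] f u \<open>\<rho> \<ge> 0\<close> unfolding flag_def
    by (intro add_mono mult_left_mono) (auto simp: graded_def M_def)
  finally show ?thesis .
qed

lemma graded_line_intersection_bounds:
  fixes q1 q2 A1 B1 A2 B2 C1 C2 :: int and L W c s t x y :: real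
  assumes st: "s \<ge> 0" "t \<ge> 0" "s + t = 1"
    and f1: "flag s t q1 p1 r1 A1 B1 C1" and f2: "flag s t q2 p2 r2 A2 B2 C2"
    and g1: "graded s t R h (W\<^sup>2) v q1 A1 B1" and g2: "graded s t R h (W\<^sup>2) v q2 A2 B2"
    and q: "q1 \<le> q2" "q2 \<le> L * q1" and W: "W \<ge> 1"
    and c: "q1 * \<bar>A1 * x + B1 * y + C1\<bar> \<le> c" "q1 * \<bar>A2 * x + B2 * y + C2\<bar> \<le> c"
  defines "D \<equiv> A1 * B2 - A2 * B1"
  shows "\<bar>real_of_int D\<bar> powr s * \<bar>D * x - real_of_int (B1 * C2 - B2 * C1)\<bar> \<le> 4 * L ^ 3 * c / W"
    and "\<bar>real_of_int D\<bar> powr t * \<bar>D * y - real_of_int (C1 * A2 - C2 * A1)\<bar> \<le> 4 * L ^ 3 * c / W"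
    and "\<bar>D * x - real_of_int (B1 * C2 - B2 * C1)\<bar> \<le> 2 * L * c / W\<^sup>2"
    and "\<bar>D * y - real_of_int (C1 * A2 - C2 * A1)\<bar> \<le> 2 * L * c / W\<^sup>2"
proof -
  have q0: "q1 > 0" using f1 by (auto simp: flag_def)
  have bd: "\<bar>real_of_int A1\<bar> \<le> q1 powr s" "\<bar>real_of_int A2\<bar> \<le> q2 powr s"
       "\<bar>real_of_int B1\<bar> \<le> q1 powr t" "\<bar>real_of_int B2\<bar> \<le> q2 powr t"
    using f1 f2 by (auto simp: flag_def)
  have W2: "W\<^sup>2 * \<bar>real_of_int a\<bar> \<le> q powr max s t" if "graded s t R h (W\<^sup>2) v q A B" "a = A \<or> a = B"
    for a q A B :: int
  proof -
    have "\<bar>real_of_int a\<bar> \<le> coeff_norm A B" using that(2) by (auto simp: coeff_norm_ge)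
    then have "W\<^sup>2 * \<bar>real_of_int a\<bar> \<le> W\<^sup>2 * coeff_norm A B" by (intro mult_left_mono) auto
    then show ?thesis using that(1) by (auto simp: graded_def)
  qed
  have "1 \<le> coeff_norm A1 B1" using f1 by (auto simp: flag_def coeff_norm_ge_1)
  then have "W\<^sup>2 * 1 \<le> W\<^sup>2 * coeff_norm A1 B1" by (intro mult_left_mono) auto
  then have W1: "W\<^sup>2 \<le> q1 powr max s t" using g1 by (auto simp: graded_def)
  have "(\<bar>real_of_int D\<bar> powr s * \<bar>D * x - real_of_int (B1 * C2 - B2 * C1)\<bar> \<le> 4 * L ^ 3 * c / W \<and>
    \<bar>real_of_int D\<bar> powr t * \<bar>D * y - real_of_int (C1 * A2 - C2 * A1)\<bar> \<le> 4 * L ^ 3 * c / W) \<and>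
    \<bar>D * x - real_of_int (B1 * C2 - B2 * C1)\<bar> \<le> 2 * L * c / W\<^sup>2 \<and>
    \<bar>D * y - real_of_int (C1 * A2 - C2 * A1)\<bar> \<le> 2 * L * c / W\<^sup>2"
  proof (cases "t \<le> s")
    case True
    then have m: "max s t = s" by simp
    note I = line_intersection_bounds[OF True st(2,3) _ _ q(2) W W1[unfolded m]
        W2[OF g1, of A1, unfolded m] W2[OF g2, of A2, unfolded m] bd(3,4) c]
    show ?thesis unfolding D_def using I q q0 by simp
  next
    case False
    then have m: "max s t = t" and le: "s \<le> t" and ts: "t + s = 1" using st by auto
    \<comment> \<open>The case s < t follows by exchanging the coordinates, that is \<open>A\<close>
      with \<open>B\<close> and x with y; \<open>D\<close> and both numerators only change
      sign.\<close>
    have c': "q1 * \<bar>B1 * y + A1 * x + C1\<bar> \<le> c" "q1 * \<bar>B2 * y + A2 * x + C2\<bar> \<le> c"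
      using c by (simp_all add: add.commute)
    note I = line_intersection_bounds[OF le st(1) ts _ _ q(2) W W1[unfolded m]
        W2[OF g1, of B1, unfolded m] W2[OF g2, of B2, unfolded m] bd(1,2) c']
    have e: "\<bar>real_of_int D\<bar> = \<bar>real_of_int B1 * A2 - B2 * A1\<bar>"
      "\<bar>D * x - real_of_int (B1 * C2 - B2 * C1)\<bar> = \<bar>(real_of_int B1 * A2 - B2 * A1) * x - (C1 * B2 - C2 * B1)\<bar>"
      "\<bar>D * y - real_of_int (C1 * A2 - C2 * A1)\<bar> = \<bar>(real_of_int B1 * A2 - B2 * A1) * y - (A1 * C2 - A2 * C1)\<bar>"
      by (simp_all add: D_def algebra_simps)
    show ?thesis unfolding e using I q q0 by simp
  qed
  then show "\<bar>real_of_int D\<bar> powr s * \<bar>D * x - real_of_int (B1 * C2 - B2 * C1)\<bar> \<le> 4 * L ^ 3 * c / W"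
    and "\<bar>real_of_int D\<bar> powr t * \<bar>D * y - real_of_int (C1 * A2 - C2 * A1)\<bar> \<le> 4 * L ^ 3 * c / W"
    and "\<bar>D * x - real_of_int (B1 * C2 - B2 * C1)\<bar> \<le> 2 * L * c / W\<^sup>2"
    and "\<bar>D * y - real_of_int (C1 * A2 - C2 * A1)\<bar> \<le> 2 * L * c / W\<^sup>2"
    by blast+
qed

section \<open>Collinearity of the points in a stratum\<close>

text \<open>The intersection of the two lines would be a rational point with denominator |D| whose
  box contains \<open>K\<close>, contrary to the second part of \<open>K\<close>. So the lines are
  parallel, in fact equal, and the bound known for the second line passes to the first.\<close>

lemma collinear_step:
  fixes \<epsilon> h R W v \<rho> L c s t :: real and K :: "(real \<times> real) set"
  assumes st: "s \<ge> 0" "t \<ge> 0" "s + t = 1"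
    and f1: "flag s t q1 p1 r1 A1 B1 C1" and f2: "flag s t q2 p2 r2 A2 B2 C2"
    and g1: "graded s t R h (W\<^sup>2) v q1 A1 B1" and g2: "graded s t R h (W\<^sup>2) v q2 A2 B2"
    and q: "q1 \<le> q2" "q2 \<le> L * q1" and pos: "h > 0" "W \<ge> 1" "\<rho> \<ge> 0"
    and u1: "u1 \<in> approx_box s t \<epsilon> q1 p1 r1" and u2: "u2 \<in> approx_box s t \<epsilon> q2 p2 r2"
    and d: "\<And>z. z \<in> K \<Longrightarrow> \<bar>fst z - fst u1\<bar> \<le> 2 * \<rho>" "\<And>z. z \<in> K \<Longrightarrow> \<bar>snd z - snd u1\<bar> \<le> 2 * \<rho>"
      "\<And>z. z \<in> K \<Longrightarrow> \<bar>fst z - fst u2\<bar> \<le> 2 * \<rho>" "\<And>z. z \<in> K \<Longrightarrow> \<bar>snd z - snd u2\<bar> \<le> 2 * \<rho>"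
    and K: "K \<noteq> {}" "\<not> (\<exists>q p r. q > 0 \<and> K \<subseteq> approx_box s t \<epsilon> q p r)"
    and c: "4 * \<rho> * (R * h) + 2 * \<epsilon> \<le> c" "4 * L ^ 3 * c / W \<le> \<epsilon>" "2 * L * c / W\<^sup>2 < 1"
    and z: "z \<in> approx_box s t \<epsilon> q2 p2 r2"
  shows "h * \<bar>A1 * fst z + B1 * snd z + C1\<bar> \<le> 2 * \<epsilon> * coeff_norm A1 B1"
proof -
  have q0: "q1 > 0" "q2 > 0" using f1 f2 by (auto simp: flag_def)
  define D P Q where "D = A1 * B2 - A2 * B1" and "P = B1 * C2 - B2 * C1" and "Q = C1 * A2 - C2 * A1"
  have near: "\<bar>real_of_int D\<bar> powr s * \<bar>D * fst w - real_of_int P\<bar> \<le> \<epsilon>"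
    "\<bar>real_of_int D\<bar> powr t * \<bar>D * snd w - real_of_int Q\<bar> \<le> \<epsilon>"
    "\<bar>D * fst w - real_of_int P\<bar> < 1" "\<bar>D * snd w - real_of_int Q\<bar> < 1" if w: "w \<in> K" for w :: "real \<times> real"
  proof -
    have n1: "q1 * \<bar>A1 * fst w + B1 * snd w + C1\<bar> \<le> c"
      using line_near_disk[OF f1 g1 u1 pos(3) d(1,2)[OF w]] c(1) by linarith
    have "q1 * \<bar>A2 * fst w + B2 * snd w + C2\<bar> \<le> q2 * \<bar>A2 * fst w + B2 * snd w + C2\<bar>"
      using q(1) by (intro mult_right_mono) auto
    then have n2: "q1 * \<bar>A2 * fst w + B2 * snd w + C2\<bar> \<le> c"
      using line_near_disk[OF f2 g2 u2 pos(3) d(3,4)[OF w]] c(1) by linarith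
    note I = graded_line_intersection_bounds[OF st f1 f2 g1 g2 q pos(2) n1 n2, folded D_def P_def Q_def]
    show "\<bar>real_of_int D\<bar> powr s * \<bar>D * fst w - real_of_int P\<bar> \<le> \<epsilon>"
      "\<bar>real_of_int D\<bar> powr t * \<bar>D * snd w - real_of_int Q\<bar> \<le> \<epsilon>"
      "\<bar>D * fst w - real_of_int P\<bar> < 1" "\<bar>D * snd w - real_of_int Q\<bar> < 1"
      using I c(2,3) by linarith+
  qed
  have "D = 0"
  proof (rule ccontr)
    assume "D \<noteq> 0"
    \<comment> \<open>A box asks for a positive denominator, hence the factor \<open>sgn D\<close>
      in the numerators.\<close>
    have "w \<in> approx_box s t \<epsilon> \<bar>D\<bar> (sgn D * P) (sgn D * Q)" if "w \<in> K" for w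
    proof -
      have "\<bar>real_of_int \<bar>D\<bar> * x - real_of_int (sgn D * y)\<bar> = \<bar>D * x - real_of_int y\<bar>" for x :: real and y :: int
        using \<open>D \<noteq> 0\<close> by (cases "D > 0") (auto simp: abs_minus_commute)
      then show ?thesis using near[OF that] unfolding approx_box_def by simp
    qed
    with K(2) \<open>D \<noteq> 0\<close> show False by (metis subsetI zero_less_abs_iff)
  qed
  obtain w where "w \<in> K" using K(1) by blast
  \<comment> \<open>With D = 0 the bounds leave integers of modulus below 1. All minors of the two
    coefficient triples now vanish, so the triples are proportional.\<close>
  from near(3,4)[OF this] have "P = 0" "Q = 0" unfolding \<open>D = 0\<close> by auto
  define F1 F2 where "F1 = \<bar>A1 * fst z + B1 * snd z + C1\<bar>" and "F2 = \<bar>A2 * fst z + B2 * snd z + C2\<bar>"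
  define M1 M2 where "M1 = coeff_norm A1 B1" and "M2 = coeff_norm A2 B2"
  have eqs: "real_of_int A1 * B2 = A2 * B1" "real_of_int B1 * C2 = B2 * C1" "real_of_int C1 * A2 = C2 * A1"
    using \<open>D = 0\<close> \<open>P = 0\<close> \<open>Q = 0\<close> unfolding D_def P_def Q_def
    by (simp_all flip: of_int_mult)
  have "real_of_int A2 * (A1 * fst z + B1 * snd z + C1) = A1 * (A2 * fst z + B2 * snd z + C2)
      - snd z * (A1 * B2 - real_of_int (A2 * B1)) + (C1 * A2 - real_of_int (C2 * A1))"
    "real_of_int B2 * (A1 * fst z + B1 * snd z + C1) = B1 * (A2 * fst z + B2 * snd z + C2)
      + fst z * (A1 * B2 - real_of_int (A2 * B1)) - (B1 * C2 - real_of_int (B2 * C1))"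
    by (simp_all add: algebra_simps)
  then have "real_of_int A2 * (A1 * fst z + B1 * snd z + C1) = A1 * (A2 * fst z + B2 * snd z + C2)"
    "real_of_int B2 * (A1 * fst z + B1 * snd z + C1) = B1 * (A2 * fst z + B2 * snd z + C2)"
    using eqs by simp_all
  then have "\<bar>real_of_int A2\<bar> * F1 = \<bar>real_of_int A1\<bar> * F2" "\<bar>real_of_int B2\<bar> * F1 = \<bar>real_of_int B1\<bar> * F2"
    unfolding F1_def F2_def by (metis abs_mult)+
  moreover have "\<bar>real_of_int A1\<bar> * F2 \<le> M1 * F2" "\<bar>real_of_int B1\<bar> * F2 \<le> M1 * F2"
    unfolding M1_def F2_def by (intro mult_right_mono coeff_norm_ge; simp)+
  \<comment> \<open>Dividing by the coefficient norm makes the forms of proportional lines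
    comparable.\<close>
  ultimately have MF: "M2 * F1 \<le> M1 * F2"
    unfolding M2_def coeff_norm_def by (auto simp: max_def)
  have M2: "M2 \<ge> 1" using f2 unfolding M2_def by (intro coeff_norm_ge_1) (auto simp: flag_def)
  have M1: "M1 \<ge> 1" using f1 unfolding M1_def by (intro coeff_norm_ge_1) (auto simp: flag_def)
  have "q2 * F2 \<le> 2 * \<epsilon>"
    unfolding F2_def using f2 z by (intro line_bound[of A2 p2 B2 r2 C2 q2 s t z]) (auto simp: flag_def)
  moreover have "F2 \<ge> 0" by (simp add: F2_def)
  ultimately have "h * F2 \<le> (q2 * M2) * F2" "M2 * (q2 * F2) \<le> M2 * (2 * \<epsilon>)"
    using g2 M2 by (auto simp: graded_def M2_def intro!: mult_right_mono mult_left_mono)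
  then have hF: "h * F2 \<le> M2 * (2 * \<epsilon>)" by (simp add: algebra_simps)
  have "M2 * (h * F1) = h * (M2 * F1)" by simp
  also have "\<dots> \<le> h * (M1 * F2)" by (rule mult_left_mono[OF MF]) (use pos in simp)
  also have "\<dots> = M1 * (h * F2)" by simp
  also have "\<dots> \<le> M1 * (M2 * (2 * \<epsilon>))" by (rule mult_left_mono[OF hF]) (use M1 in simp)
  also have "\<dots> = M2 * (2 * \<epsilon> * M1)" by simp
  finally show ?thesis unfolding F1_def M1_def using M2 by (simp add: mult_le_cancel_left)
qed

section \<open>Strata of boxes and the strips enclosing them\<close>

definition stratum ::
  "real \<Rightarrow> real \<Rightarrow> real \<Rightarrow> real \<Rightarrow> real \<Rightarrow> real \<Rightarrow> real \<Rightarrow> (real \<times> real) set \<Rightarrow> (real \<times> real) set" where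
  "stratum s t \<epsilon> R h u v K = {z. \<exists>q p r A B C. flag s t q p r A B C \<and> graded s t R h u v q A B \<and>
     approx_box s t \<epsilon> q p r \<inter> K \<noteq> {} \<and> z \<in> approx_box s t \<epsilon> q p r}"

text \<open>Only containment in a strip is required. The normalisation by the maximum norm makes the
  Euclidean half-width at most \<open>w\<close>.\<close>

definition strip :: "real \<Rightarrow> (real \<times> real) set \<Rightarrow> bool" where
  "strip w S \<longleftrightarrow> (\<exists>a b c. max \<bar>a\<bar> \<bar>b\<bar> = 1 \<and> S \<subseteq> {z. \<bar>a * fst z + b * snd z + c\<bar> \<le> w})"

lemma abs_diff_le_dist:
  fixes x y :: "real \<times> real"
  shows "\<bar>fst x - fst y\<bar> \<le> dist x y" "\<bar>snd x - snd y\<bar> \<le> dist x y"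
  using dist_fst_le[of x y] dist_snd_le[of x y] by (auto simp: dist_real_def)

lemma strip_empty: "strip w {}"
  unfolding strip_def by (intro exI[of _ 1]) auto

text \<open>The line of a point with least denominator in the stratum serves all the others; this is
  why the collinearity lemmas assume q1 <= q2. The first alternative of \<open>small\<close> feeds
  \<open>collinear_base\<close>, the second \<open>collinear_step\<close>.\<close>

lemma stratum_strip:
  fixes s t \<epsilon> R h W V \<rho> :: real
  assumes st: "s \<ge> 0" "t \<ge> 0" "s + t = 1" and pos: "R \<ge> 1" "h > 0" "\<rho> \<ge> 0" "1 \<le> W" "W \<le> V" "\<epsilon> > 0"
    and no: "\<not> (\<exists>q p r. q > 0 \<and> cball x \<rho> \<subseteq> approx_box s t \<epsilon> q p r)"
    and small: "W = 1 \<and> V\<^sup>2 * R * (4 * \<rho> * (R * h) + 4 * \<epsilon>) < 1 \<or>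
      L = V\<^sup>2 / W\<^sup>2 * R \<and> c = 4 * \<rho> * (R * h) + 2 * \<epsilon> \<and> 4 * L ^ 3 * c / W \<le> \<epsilon> \<and> 2 * L * c / W\<^sup>2 < 1"
  shows "strip (2 * \<epsilon> / h) (stratum s t \<epsilon> R h (W\<^sup>2) (V\<^sup>2) (cball x \<rho>))"
proof (cases "stratum s t \<epsilon> R h (W\<^sup>2) (V\<^sup>2) (cball x \<rho>) = {}")
  case True
  then show ?thesis by (simp add: strip_empty)
next
  case False
  define ok where "ok q p r A B C \<longleftrightarrow> flag s t q p r A B C \<and> graded s t R h (W\<^sup>2) (V\<^sup>2) q A B \<and>
     approx_box s t \<epsilon> q p r \<inter> cball x \<rho> \<noteq> {}" for q p r A B C
  have W2: "0 < W\<^sup>2" "W\<^sup>2 \<le> V\<^sup>2" "1 \<le> V\<^sup>2" using pos by (auto intro!: power_mono one_le_power)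
  define N where "N n \<longleftrightarrow> (\<exists>q p r A B C. ok q p r A B C \<and> nat q = n)" for n
  have "\<exists>n. N n" using False unfolding stratum_def N_def ok_def by blast
  then obtain n where "N n" and least: "\<And>m. N m \<Longrightarrow> n \<le> m"
    by (metis LeastI_ex Least_le)
  then obtain q1 p1 r1 A1 B1 C1 where ok1: "ok q1 p1 r1 A1 B1 C1" and n: "nat q1 = n"
    unfolding N_def by blast
  then obtain u1 where u1: "u1 \<in> approx_box s t \<epsilon> q1 p1 r1" "u1 \<in> cball x \<rho>" unfolding ok_def by blast
  have f1: "flag s t q1 p1 r1 A1 B1 C1" and g1: "graded s t R h (W\<^sup>2) (V\<^sup>2) q1 A1 B1"
    using ok1 by (auto simp: ok_def)
  have d: "\<bar>fst y - fst z\<bar> \<le> 2 * \<rho>" "\<bar>snd y - snd z\<bar> \<le> 2 * \<rho>" if "y \<in> cball x \<rho>" "z \<in> cball x \<rho>" for y z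
  proof -
    have "dist y z \<le> 2 * \<rho>" using that dist_triangle3[of y z x] by simp
    then show "\<bar>fst y - fst z\<bar> \<le> 2 * \<rho>" "\<bar>snd y - snd z\<bar> \<le> 2 * \<rho>"
      using abs_diff_le_dist[of y z] by linarith+
  qed
  have main: "h * \<bar>A1 * fst z + B1 * snd z + C1\<bar> \<le> 2 * \<epsilon> * coeff_norm A1 B1"
    if z: "z \<in> stratum s t \<epsilon> R h (W\<^sup>2) (V\<^sup>2) (cball x \<rho>)" for z :: "real \<times> real"
  proof -
    obtain q2 p2 r2 A2 B2 C2 where ok2: "ok q2 p2 r2 A2 B2 C2" and z: "z \<in> approx_box s t \<epsilon> q2 p2 r2"
      using z unfolding stratum_def ok_def by blast
    obtain u2 where u2: "u2 \<in> approx_box s t \<epsilon> q2 p2 r2" "u2 \<in> cball x \<rho>" using ok2 unfolding ok_def by blast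
    have f2: "flag s t q2 p2 r2 A2 B2 C2" and g2: "graded s t R h (W\<^sup>2) (V\<^sup>2) q2 A2 B2"
      using ok2 by (auto simp: ok_def)
    have q0: "q1 > 0" "q2 > 0" using f1 f2 by (auto simp: flag_def)
    have "n \<le> nat q2" using ok2 unfolding N_def by (intro least[unfolded N_def]) blast
    with n q0 have q: "q1 \<le> q2" by simp
    show ?thesis
      using small
    proof (elim disjE conjE)
      assume W: "W = 1" and sm: "V\<^sup>2 * R * (4 * \<rho> * (R * h) + 4 * \<epsilon>) < 1"
      show ?thesis
        by (rule collinear_base[OF st(1,2) f1 f2 g1[unfolded W power_one] g2[unfolded W power_one] q
              pos(1,2) W2(3) pos(3) u1(1) u2(1) d[OF u1(2) u2(2)] sm z])
    next
      assume "L = V\<^sup>2 / W\<^sup>2 * R" and c: "c = 4 * \<rho> * (R * h) + 2 * \<epsilon>" "4 * L ^ 3 * c / W \<le> \<epsilon>" "2 * L * c / W\<^sup>2 < 1"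
      then have "q2 \<le> L * q1" using graded_ratio[OF g1 g2 q0 W2(1,2) pos(1,2) st(1)] by simp
      moreover have "cball x \<rho> \<noteq> {}" using pos by simp
      ultimately show ?thesis
        using c z by (intro collinear_step[OF st f1 f2 g1 g2 q _ pos(2,4,3) u1(1) u2(1) _ _ _ _ _ no])
          (auto intro!: d u1 u2)
    qed
  qed
  define M where "M = coeff_norm A1 B1"
  have M: "M \<ge> 1" using f1 unfolding M_def by (intro coeff_norm_ge_1) (auto simp: flag_def)
  show ?thesis unfolding strip_def
  proof (intro exI conjI subsetI CollectI)
    show "max \<bar>A1 / M\<bar> \<bar>B1 / M\<bar> = 1"
      using M by (auto simp: M_def coeff_norm_def max_def divide_simps)
    fix z assume "z \<in> stratum s t \<epsilon> R h (W\<^sup>2) (V\<^sup>2) (cball x \<rho>)"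
    from main[OF this] have m: "h * \<bar>A1 * fst z + B1 * snd z + C1\<bar> \<le> 2 * \<epsilon> * M" by (simp add: M_def)
    have "A1 / M * fst z + B1 / M * snd z + C1 / M = (A1 * fst z + B1 * snd z + C1) / M"
      by (simp add: add_divide_distrib)
    also have "\<bar>\<dots>\<bar> = \<bar>A1 * fst z + B1 * snd z + C1\<bar> / M" using M by simp
    also have "\<dots> \<le> 2 * \<epsilon> / h" using m M pos by (simp add: field_simps)
    finally show "\<bar>A1 / M * fst z + B1 / M * snd z + C1 / M\<bar> \<le> 2 * \<epsilon> / h" .
  qed
qed

section \<open>Avoiding strips in Schmidt's game\<close>

text \<open>Since |a| and |b| are at most 1, meeting a disk bounds the form at its centre by w + 2
  r. Comparing the three centres bounds both |a h| and |b h| by 2 (w + 2 r), while one of |a|, |b|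
  is 1.\<close>

lemma strip_misses_triangle:
  assumes T: "strip w T" and r: "r \<ge> 0" and wh: "2 * w + 4 * r < h"
    and "T \<inter> cball (x, y) r \<noteq> {}" "T \<inter> cball (x + h, y) r \<noteq> {}" "T \<inter> cball (x, y + h) r \<noteq> {}"
  shows False
proof -
  obtain a b c where abc: "max \<bar>a\<bar> \<bar>b\<bar> = 1" and sub: "T \<subseteq> {z. \<bar>a * fst z + b * snd z + c\<bar> \<le> w}"
    using T unfolding strip_def by blast
  have near: "\<bar>a * u + b * v + c\<bar> \<le> w + 2 * r" if "T \<inter> cball (u, v) r \<noteq> {}" for u v
  proof -
    from that obtain z where z: "z \<in> T" "dist (u, v) z \<le> r" by auto
    have d: "\<bar>u - fst z\<bar> \<le> r" "\<bar>v - snd z\<bar> \<le> r"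
      using z(2) abs_diff_le_dist[of "(u, v)" z] by auto
    have "\<bar>a\<bar> * \<bar>u - fst z\<bar> \<le> 1 * r" "\<bar>b\<bar> * \<bar>v - snd z\<bar> \<le> 1 * r"
      using abc d by (intro mult_mono; linarith)+
    then have "\<bar>a * (u - fst z)\<bar> \<le> r" "\<bar>b * (v - snd z)\<bar> \<le> r" by (auto simp: abs_mult)
    moreover have "\<bar>a * fst z + b * snd z + c\<bar> \<le> w" using sub z by auto
    ultimately show ?thesis unfolding right_diff_distrib by linarith
  qed
  have "\<bar>a * h\<bar> \<le> 2 * (w + 2 * r)" "\<bar>b * h\<bar> \<le> 2 * (w + 2 * r)"
    using near[OF assms(4)] near[OF assms(5)] near[OF assms(6)] unfolding distrib_left by linarith+
  moreover have "\<bar>a\<bar> = 1 \<or> \<bar>b\<bar> = 1" using abc by linarith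
  ultimately have "\<bar>h\<bar> \<le> 2 * (w + 2 * r)" by (auto simp: abs_mult)
  then show False using wh abs_ge_self[of h] by (simp add: algebra_simps)
qed

text \<open>\<open>T m k\<close> is the \<open>k\<close>-th set that Alice learns of in round \<open>m\<close>.\<close>

definition potential :: "(nat \<Rightarrow> nat \<Rightarrow> (real \<times> real) set) \<Rightarrow> nat \<Rightarrow> disk \<Rightarrow> real" where
  "potential T n D = (\<Sum>m\<le>n. \<Sum>k. if T m k \<inter> disk_set D \<noteq> {} then (4/5) ^ (m + k + 1) else 0)"

section \<open>Weights and their decrease under Alice's moves\<close>

lemma weight_summable:
  "summable (\<lambda>k. if P k then (4/5::real) ^ (m + k + 1) else 0)"
proof (rule summable_comparison_test')
  show "summable (\<lambda>k. (4/5::real) ^ (m + 1) * (4/5) ^ k)" by (intro summable_mult summable_geometric) simp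
  show "norm (if P k then (4/5::real) ^ (m + k + 1) else 0) \<le> (4/5) ^ (m + 1) * (4/5) ^ k" if "0 \<le> k" for k
    by (simp add: power_add)
qed

lemma weight_suminf_le:
  "(\<Sum>k. if P k then (4/5::real) ^ (m + k + 1) else 0) \<le> 4 * (4/5) ^ m"
proof -
  have s: "summable (\<lambda>k. (4/5::real) ^ (m + 1) * (4/5) ^ k)" by (intro summable_mult summable_geometric) simp
  have "(\<Sum>k. if P k then (4/5::real) ^ (m + k + 1) else 0) \<le> (\<Sum>k. (4/5::real) ^ (m + 1) * (4/5) ^ k)"
    by (intro suminf_le weight_summable s) (simp add: power_add)
  also have "\<dots> = (4/5) ^ (m + 1) * (\<Sum>k. (4/5::real) ^ k)"
    by (intro suminf_mult summable_geometric) simp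
  also have "\<dots> = 4 * (4/5) ^ m" by (subst suminf_geometric) auto
  finally show ?thesis .
qed

lemma potential_mono:
  assumes "disk_set E \<subseteq> disk_set D"
  shows "potential T n E \<le> potential T n D"
  unfolding potential_def using assms by (intro sum_mono suminf_le weight_summable) auto

lemma weight_le_potential:
  assumes "m \<le> n" "T m k \<inter> disk_set D \<noteq> {}"
  shows "(4/5) ^ (m + k + 1) \<le> potential T n D"
proof -
  let ?f = "\<lambda>m k. if T m k \<inter> disk_set D \<noteq> {} then (4/5::real) ^ (m + k + 1) else 0"
  have "(4/5) ^ (m + k + 1) = sum (?f m) {k}" using assms by simp
  also have "\<dots> \<le> suminf (?f m)" by (intro sum_le_suminf weight_summable) auto
  also have "\<dots> = (\<Sum>m\<in>{m}. suminf (?f m))" by simp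
  also have "\<dots> \<le> (\<Sum>m\<le>n. suminf (?f m))"
    using assms by (intro sum_mono2 suminf_nonneg weight_summable) auto
  finally show ?thesis by (simp add: potential_def)
qed

lemma potential_0_le: "potential T 0 D \<le> 4"
proof -
  have "potential T 0 D = (\<Sum>k. if T 0 k \<inter> disk_set D \<noteq> {} then (4/5) ^ (0 + k + 1) else 0)"
    unfolding potential_def atMost_0 by (simp only: sum.insert finite.emptyI empty_iff sum.empty add_0_right not_False_eq_True)
  also have "\<dots> \<le> 4 * (4/5) ^ 0" by (rule weight_suminf_le)
  finally show ?thesis by simp
qed

lemma potential_Suc_le: "potential T (Suc n) D \<le> potential T n D + 4 * (4/5) ^ Suc n"
  unfolding potential_def sum.atMost_Suc by (intro add_left_mono weight_suminf_le)

lemma potential_cong: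
  "(\<And>m k. m \<le> n \<Longrightarrow> T m k = T' m k) \<Longrightarrow> potential T n D = potential T' n D"
  by (simp add: potential_def)

text \<open>A set that misses one of the three disks contributes at most twice on the left; if it
  contributes at all, it meets \<open>D\<close> and contributes twice on the right.\<close>

lemma potential_three:
  assumes "\<And>m k. m \<le> n \<Longrightarrow> T m k \<inter> disk_set D1 \<noteq> {} \<Longrightarrow> T m k \<inter> disk_set D2 \<noteq> {} \<Longrightarrow> T m k \<inter> disk_set D3 \<noteq> {} \<Longrightarrow> False"
    and "disk_set D1 \<subseteq> disk_set D" "disk_set D2 \<subseteq> disk_set D" "disk_set D3 \<subseteq> disk_set D"
  shows "potential T n D1 + potential T n D2 + potential T n D3 \<le> 2 * potential T n D"
proof -
  let ?f = "\<lambda>D m k. if T m k \<inter> disk_set D \<noteq> {} then (4/5::real) ^ (m + k + 1) else 0"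
  have "(\<Sum>k. ?f D1 m k) + (\<Sum>k. ?f D2 m k) + (\<Sum>k. ?f D3 m k) \<le> 2 * (\<Sum>k. ?f D m k)" if "m \<le> n" for m
  proof -
    have "(\<Sum>k. ?f D1 m k) + (\<Sum>k. ?f D2 m k) + (\<Sum>k. ?f D3 m k) = (\<Sum>k. ?f D1 m k + ?f D2 m k + ?f D3 m k)"
      by (simp only: suminf_add weight_summable summable_add)
    also have "\<dots> \<le> (\<Sum>k. 2 * ?f D m k)"
    proof (intro suminf_le summable_add summable_mult weight_summable)
      fix k
      show "?f D1 m k + ?f D2 m k + ?f D3 m k \<le> 2 * ?f D m k"
      proof (cases "T m k \<inter> disk_set D \<noteq> {}")
        case True
        then show ?thesis using assms(1)[OF that, of k] by auto
      next
        case False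
        then have "T m k \<inter> disk_set D1 = {}" "T m k \<inter> disk_set D2 = {}" "T m k \<inter> disk_set D3 = {}"
          using assms(2-4) by auto
        then show ?thesis by simp
      qed
    qed
    also have "\<dots> = 2 * (\<Sum>k. ?f D m k)" by (intro suminf_mult weight_summable)
    finally show ?thesis .
  qed
  then have "(\<Sum>m\<le>n. (\<Sum>k. ?f D1 m k) + (\<Sum>k. ?f D2 m k) + (\<Sum>k. ?f D3 m k)) \<le> (\<Sum>m\<le>n. 2 * (\<Sum>k. ?f D m k))"
    by (intro sum_mono) auto
  then show ?thesis by (simp only: potential_def sum.distrib sum_distrib_left)
qed

lemma potential_decreasing_move:
  assumes \<alpha>: "0 < \<alpha>" "\<alpha> \<le> 1/32" and \<rho>: "radius D > 0"
    and T: "\<And>m k. m \<le> n \<Longrightarrow> T m k \<inter> disk_set D \<noteq> {} \<Longrightarrow> strip (radius D / 32) (T m k)"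
  shows "\<exists>E. legal_move \<alpha> D E \<and> potential T n E \<le> 2/3 * potential T n D"
proof -
  obtain x y \<rho>' where D: "D = ((x, y), \<rho>')" by (metis prod.exhaust)
  then have \<rho>': "\<rho>' > 0" "radius D = \<rho>'" using \<rho> by auto
  \<comment> \<open>\<open>h\<close> is the largest shift of the centre that keeps a disk of radius
    \<open>r\<close> inside \<open>D\<close>.\<close>
  define h r where "h = (1 - \<alpha>) * \<rho>'" and "r = \<alpha> * \<rho>'"
  have hr: "h + r = \<rho>'" "h \<ge> 0" "r \<ge> 0" using \<alpha> \<rho>' by (auto simp: h_def r_def algebra_simps)
  \<comment> \<open>As r <= \<rho>'/32, the left side is at most 6/32 \<rho>', while h >= 31/32
    \<rho>'.\<close>
  have wh: "2 * (\<rho>' / 32) + 4 * r < h"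
  proof -
    have "r \<le> 1/32 * \<rho>'" unfolding r_def using \<alpha> \<rho>' by (intro mult_right_mono) auto
    then show ?thesis using hr \<rho>' by linarith
  qed
  define E where "E u = (u, r)" for u :: "real \<times> real"
  have legal: "legal_move \<alpha> D (E u)" if "dist u (x, y) \<le> h" for u
  proof -
    have "dist u (x, y) + r \<le> \<rho>'" using that hr by linarith
    then have "cball u r \<subseteq> cball (x, y) \<rho>'" unfolding cball_subset_cball_iff by simp
    then show ?thesis by (simp add: legal_move_def disk_set_def D E_def r_def)
  qed
  have d: "dist (x, y) (x, y) \<le> h" "dist (x + h, y) (x, y) \<le> h" "dist (x, y + h) (x, y) \<le> h"
    using hr by (auto simp: dist_Pair_Pair dist_real_def)
  note L = d[THEN legal]
  then have sub: "disk_set (E (x, y)) \<subseteq> disk_set D" "disk_set (E (x + h, y)) \<subseteq> disk_set D" "disk_set (E (x, y + h)) \<subseteq> disk_set D"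
    by (auto simp: legal_move_def)
  have "potential T n (E (x, y)) + potential T n (E (x + h, y)) + potential T n (E (x, y + h)) \<le> 2 * potential T n D"
  proof (rule potential_three[OF _ sub])
    fix m k assume mk: "m \<le> n" "T m k \<inter> disk_set (E (x, y)) \<noteq> {}"
      "T m k \<inter> disk_set (E (x + h, y)) \<noteq> {}" "T m k \<inter> disk_set (E (x, y + h)) \<noteq> {}"
    then have "strip (\<rho>' / 32) (T m k)" using T[of m k] sub \<rho>' by auto
    from strip_misses_triangle[OF this hr(3) wh] mk(2-4) show False
      by (simp add: disk_set_def E_def)
  qed
  then have "potential T n (E (x, y)) \<le> 2/3 * potential T n D \<or> potential T n (E (x + h, y)) \<le> 2/3 * potential T n D
     \<or> potential T n (E (x, y + h)) \<le> 2/3 * potential T n D" by linarith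
  then show ?thesis using L by blast
qed

section \<open>From decreasing weights to a winning strategy\<close>

lemma strip_mono:
  assumes "strip w S" "w \<le> w'"
  shows "strip w' S"
proof -
  obtain a b c where "max \<bar>a\<bar> \<bar>b\<bar> = 1" "S \<subseteq> {z. \<bar>a * fst z + b * snd z + c\<bar> \<le> w}"
    using assms(1) unfolding strip_def by blast
  moreover have "{z. \<bar>a * fst z + b * snd z + c\<bar> \<le> w} \<subseteq> {z. \<bar>a * fst z + b * snd z + c\<bar> \<le> w'}"
    using assms(2) by auto
  ultimately show ?thesis unfolding strip_def by (meson order_trans)
qed

text \<open>15 is the least exponent e with 24 (4/5)^e < 1. With j = m + k + 1 this leads to the
  exponent m + k + 16 in the widths of the strips.\<close>

lemma weight_bound:
  assumes "(4/5::real) ^ j \<le> 24 * (4/5) ^ n"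
  shows "n \<le> j + 14"
proof (rule ccontr)
  assume "\<not> ?thesis"
  then have "(4/5::real) ^ n \<le> (4/5) ^ (j + 15)" by (intro power_decreasing) auto
  then have "24 * (4/5::real) ^ n \<le> (24 * (4/5) ^ 15) * (4/5) ^ j"
    unfolding power_add by (simp only: ac_simps mult_le_cancel_left_pos zero_less_numeral)
  also have "\<dots> < 1 * (4/5) ^ j" by (intro mult_strict_right_mono) (auto simp: power_divide)
  finally show False using assms by simp
qed

text \<open>Alice keeps the potential of Bob's n-th disk at most 24 (4/5)^n. A set that still meets
  this disk is then light, so of large index, and thin enough for the next move.\<close>

lemma game_winning_by_strips:
  fixes S :: "real \<Rightarrow> nat \<Rightarrow> nat \<Rightarrow> disk \<Rightarrow> (real \<times> real) set"
  assumes \<alpha>: "0 < \<alpha>" "\<alpha> \<le> 1/32" and \<beta>: "0 < \<beta>" "\<beta> < 1" and R: "R = 1 / (\<alpha> * \<beta>)"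
    and S: "\<And>\<rho> m k D. \<rho> > 0 \<Longrightarrow> radius D = \<rho> / R ^ m \<Longrightarrow> strip (\<rho> / R ^ (m + k + 16)) (S \<rho> m k D)"
    and X: "\<And>B p. radius (B 0) > 0 \<Longrightarrow> (\<And>n. radius (B n) = radius (B 0) / R ^ n) \<Longrightarrow>
      (\<And>n. p \<in> disk_set (B n)) \<Longrightarrow> (\<And>m k. p \<notin> S (radius (B 0)) m k (B m)) \<Longrightarrow> p \<in> X"
  shows "game_winning \<alpha> \<beta> X"
proof -
  \<comment> \<open>The strategy sees only the list of Bob's disks: the head gives the initial
    radius, entry \<open>m\<close> the disk of round \<open>m\<close>, and the length minus one the
    current round.\<close>
  define good where "good Bs E \<longleftrightarrow> legal_move \<alpha> (last Bs) E \<and>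
     (let T = (\<lambda>m k. S (radius (hd Bs)) m k (Bs ! m)); n = length Bs - 1 in
      potential T n E \<le> 2/3 * potential T n (last Bs))" for Bs E
  define \<sigma> where "\<sigma> Bs = (SOME E. good Bs E)" for Bs
  define T where "T B m k = S (radius (B 0)) m k (B m)" for B :: "nat \<Rightarrow> disk" and m k
  have good_iff: "good (map B [0..<Suc n]) E \<longleftrightarrow> legal_move \<alpha> (B n) E \<and>
      potential (T B) n E \<le> 2/3 * potential (T B) n (B n)" for B n E
  proof -
    have "potential (\<lambda>m k. S (radius (hd (map B [0..<Suc n]))) m k (map B [0..<Suc n] ! m)) n F = potential (T B) n F" for F
      unfolding T_def by (intro potential_cong) (simp add: hd_map less_Suc_eq_le nth_append del: upt_Suc)
    then show ?thesis unfolding good_def Let_def by simp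
  qed
  have ab: "\<alpha> * \<beta> > 0" using \<alpha> \<beta> by simp
  have "\<alpha> * \<beta> \<le> 1/32 * 1" using \<alpha> \<beta> by (intro mult_mono) auto
  then have R32: "R \<ge> 32" using ab unfolding R by (simp add: field_simps)
  have answer: "good (map B [0..<Suc n]) (alice \<sigma> B n)"
    if r0: "radius (B 0) > 0" and rad: "\<And>m. m \<le> n \<Longrightarrow> radius (B m) = radius (B 0) / R ^ m"
      and pot: "potential (T B) n (B n) \<le> 24 * (4/5) ^ n" for B n
  proof -
    have pos: "radius (B n) > 0" using r0 rad[of n] R32 by simp
    have "strip (radius (B n) / 32) (T B m k)" if "m \<le> n" "T B m k \<inter> disk_set (B n) \<noteq> {}" for m k
    proof -
      have "(4/5) ^ (m + k + 1) \<le> 24 * (4/5::real) ^ n"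
        using weight_le_potential[of m n "T B", OF that] pot by linarith
      then have "n \<le> m + k + 1 + 14" by (rule weight_bound)
      then have "R ^ (n + 1) \<le> R ^ (m + k + 16)" using R32 by (intro power_increasing) auto
      then have "radius (B 0) / R ^ (m + k + 16) \<le> radius (B 0) / R ^ (n + 1)"
        using r0 R32 by (intro divide_left_mono) auto
      also have "\<dots> = radius (B n) / R" using rad[of n] by simp
      also have "\<dots> \<le> radius (B n) / 32" using pos R32 by (intro divide_left_mono) auto
      finally show ?thesis
        unfolding T_def by (rule strip_mono[OF S[OF r0 rad[OF that(1)]]])
    qed
    from potential_decreasing_move[of \<alpha> "B n" n "T B", OF \<alpha> pos this] obtain E where "good (map B [0..<Suc n]) E"
      unfolding good_iff by blast
    then show ?thesis unfolding alice_def \<sigma>_def by (rule someI)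
  qed
  \<comment> \<open>Bound and answer are proved together: the bound yields a good answer, and the
    bound of the next round rests on that answer.\<close>
  have inv: "radius (B 0) > 0 \<and> (\<forall>m\<le>n. radius (B m) = radius (B 0) / R ^ m) \<and>
      potential (T B) n (B n) \<le> 24 * (4/5) ^ n \<and> good (map B [0..<Suc n]) (alice \<sigma> B n)"
    if "bob_legal_upto \<beta> \<sigma> B n" for B n
    using that
  proof (induction n)
    case 0
    then have r0: "radius (B 0) > 0" by (simp add: bob_legal_upto_def)
    have pot: "potential (T B) 0 (B 0) \<le> 24 * (4/5) ^ 0" using potential_0_le[of "T B" "B 0"] by simp
    have rad: "radius (B m) = radius (B 0) / R ^ m" if "m \<le> 0" for m using that by simp
    show ?case by (intro conjI allI impI r0 rad pot answer)
  next
    case (Suc n)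
    have legal: "bob_legal_upto \<beta> \<sigma> B n" and bob: "legal_move \<beta> (alice \<sigma> B n) (B (Suc n))"
      using Suc.prems by (simp_all add: bob_legal_upto_def)
    note IH = Suc.IH[OF legal]
    have r0: "radius (B 0) > 0" and rad: "\<And>m. m \<le> n \<Longrightarrow> radius (B m) = radius (B 0) / R ^ m"
      and pot: "potential (T B) n (B n) \<le> 24 * (4/5) ^ n"
      and A: "legal_move \<alpha> (B n) (alice \<sigma> B n)"
        "potential (T B) n (alice \<sigma> B n) \<le> 2/3 * potential (T B) n (B n)"
      using IH[THEN conjunct1] IH[THEN conjunct2, THEN conjunct1]
        IH[THEN conjunct2, THEN conjunct2, THEN conjunct1]
        IH[THEN conjunct2, THEN conjunct2, THEN conjunct2, unfolded good_iff] by blast+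
    have "radius (B (Suc n)) = \<beta> * (\<alpha> * radius (B n))" using A bob by (simp add: legal_move_def)
    also have "\<dots> = (\<alpha> * \<beta>) * (radius (B 0) / R ^ n)" using rad[of n] by simp
    also have "\<alpha> * \<beta> = 1 / R" by (simp add: R)
    also have "1 / R * (radius (B 0) / R ^ n) = radius (B 0) / R ^ Suc n" by simp
    finally have rad': "radius (B m) = radius (B 0) / R ^ m" if "m \<le> Suc n" for m
      using rad[of m] that by (cases "m = Suc n") (simp_all only: le_Suc_eq simp_thms)
    have "potential (T B) n (B (Suc n)) \<le> potential (T B) n (alice \<sigma> B n)"
      using bob by (intro potential_mono) (simp add: legal_move_def)
    \<comment> \<open>This is 20 (4/5)^(n+1), and the sets of the new round add at most 4
      (4/5)^(n+1); hence the constant 24.\<close>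
    also have "\<dots> \<le> 16 * (4/5) ^ n" using A(2) pot by simp
    finally have pot': "potential (T B) (Suc n) (B (Suc n)) \<le> 24 * (4/5) ^ Suc n"
      using potential_Suc_le[of "T B" n "B (Suc n)"] by simp
    show ?case by (intro conjI allI impI r0 rad' pot' answer)
  qed
  show ?thesis unfolding game_winning_def
  proof (intro exI[of _ \<sigma>] conjI allI impI)
    fix B n assume "bob_legal_upto \<beta> \<sigma> B n"
    then show "legal_move \<alpha> (B n) (alice \<sigma> B n)" using inv[of B n] good_iff[of B n] by blast
  next
    fix B assume legal: "\<forall>n. bob_legal_upto \<beta> \<sigma> B n"
    have r0: "radius (B 0) > 0" and rad: "radius (B n) = radius (B 0) / R ^ n"
      and pot: "potential (T B) n (B n) \<le> 24 * (4/5) ^ n"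
      and A: "legal_move \<alpha> (B n) (alice \<sigma> B n)"
      and bob: "legal_move \<beta> (alice \<sigma> B n) (B (Suc n))" for n
    proof -
      note I = inv[OF legal[rule_format, of n]]
      show "radius (B 0) > 0" "radius (B n) = radius (B 0) / R ^ n" "potential (T B) n (B n) \<le> 24 * (4/5) ^ n"
        "legal_move \<alpha> (B n) (alice \<sigma> B n)"
        using I[THEN conjunct1] I[THEN conjunct2, THEN conjunct1]
          I[THEN conjunct2, THEN conjunct2, THEN conjunct1]
          I[THEN conjunct2, THEN conjunct2, THEN conjunct2, unfolded good_iff] by blast+
      show "legal_move \<beta> (alice \<sigma> B n) (B (Suc n))"
        using legal[rule_format, of "Suc n"] by (simp add: bob_legal_upto_def)
    qed
    have AB: "disk_set (alice \<sigma> B n) \<subseteq> disk_set (B n)" "disk_set (B (Suc n)) \<subseteq> disk_set (alice \<sigma> B n)"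
      and ra: "radius (alice \<sigma> B n) = \<alpha> * radius (B n)" for n
      using A[of n] bob[of n] by (auto simp: legal_move_def)
    have "\<exists>p. (\<Inter>n. disk_set (alice \<sigma> B n)) = {p}"
    proof (rule decreasing_closed_nest_sing)
      show "closed (disk_set (alice \<sigma> B n))" for n by (simp add: disk_set_def)
      show "disk_set (alice \<sigma> B n) \<noteq> {}" for n
      proof -
        have "0 \<le> \<alpha> * (radius (B 0) / R ^ n)" using r0 \<alpha>(1) R32 by (intro mult_nonneg_nonneg divide_nonneg_nonneg) simp_all
        then show ?thesis unfolding disk_set_def ra rad[of n] by simp
      qed
      have "disk_set (alice \<sigma> B (Suc n)) \<subseteq> disk_set (alice \<sigma> B n)" for n
        using AB(1)[of "Suc n"] AB(2)[of n] by blast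
      then show "disk_set (alice \<sigma> B n) \<subseteq> disk_set (alice \<sigma> B m)" if "m \<le> n" for m n
        by (rule lift_Suc_antimono_le[OF _ that])
      fix e :: real assume "e > 0"
      have "(\<lambda>n. 2 * (\<alpha> * radius (B 0)) * (1 / R) ^ n) \<longlonglongrightarrow> 2 * (\<alpha> * radius (B 0)) * 0"
        using R32 by (intro tendsto_mult tendsto_const LIMSEQ_power_zero) auto
      then have "eventually (\<lambda>n. 2 * (\<alpha> * radius (B 0)) * (1 / R) ^ n < e) sequentially"
        using \<open>e > 0\<close> by (intro order_tendstoD) simp_all
      then obtain n where n: "2 * (\<alpha> * radius (B 0)) * (1 / R) ^ n < e"
        by (auto simp: eventually_sequentially)
      have "dist x y < e" if "x \<in> disk_set (alice \<sigma> B n)" "y \<in> disk_set (alice \<sigma> B n)" for x y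
      proof -
        have "dist x y \<le> 2 * radius (alice \<sigma> B n)"
          using that dist_triangle3[of x y "fst (alice \<sigma> B n)"] by (simp add: disk_set_def)
        also have "\<dots> = 2 * (\<alpha> * radius (B 0)) * (1 / R) ^ n"
          
          unfolding ra rad[of n] by (simp add: power_one_over)
        finally show ?thesis using n by linarith
      qed
      then show "\<exists>n. \<forall>x\<in>disk_set (alice \<sigma> B n). \<forall>y\<in>disk_set (alice \<sigma> B n). dist x y < e" by blast
    qed
    then obtain p where p: "(\<Inter>n. disk_set (alice \<sigma> B n)) = {p}" by blast
    then have pB: "p \<in> disk_set (B n)" for n using AB(1)[of n] by blast
    \<comment> \<open>By round m + k + 16 the bound on the potential has dropped below the weight
      (4/5)^(m+k+1).\<close>
    have "p \<notin> S (radius (B 0)) m k (B m)" for m k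
    proof
      assume "p \<in> S (radius (B 0)) m k (B m)"
      then have "T B m k \<inter> disk_set (B (m + k + 16)) \<noteq> {}" using pB unfolding T_def by blast
      from weight_le_potential[of m "m + k + 16" "T B", OF _ this] pot[of "m + k + 16"]
      have "m + k + 16 \<le> m + k + 1 + 14" by (intro weight_bound) simp
      then show False by simp
    qed
    then have "p \<in> X" using X[of B p] r0 rad pB by blast
    with p show "\<exists>p\<in>X. (\<Inter>n. disk_set (alice \<sigma> B n)) = {p}" by blast
  qed
qed

section \<open>Strategy for badly approximable vectors\<close>

lemma ex_crossing:
  fixes f :: "nat \<Rightarrow> 'a :: linorder"
  assumes "f 0 \<le> x" "x < f n"
  shows "\<exists>k. f k \<le> x \<and> x < f (Suc k)"
proof (rule ccontr)
  assume "\<not> ?thesis"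
  then have "f k \<le> x" for k using assms(1) by (induction k) (auto simp: not_less)
  with assms(2) show False by (simp add: not_le[symmetric])
qed

section \<open>Bad approximability in terms of boxes\<close>

lemma dist_int_attained: "\<exists>p::int. dist_int z = \<bar>z - p\<bar>"
proof -
  have "closed (\<int> :: real set)" "(\<int> :: real set) \<noteq> {}" using closed_Ints by auto
  from infdist_attains_inf[OF this, of z] show ?thesis
    unfolding dist_int_def by (auto simp: dist_real_def elim!: Ints_cases)
qed

lemma Bad_if_avoids_boxes:
  assumes "\<epsilon> > 0" and no: "\<And>q p r. q > 0 \<Longrightarrow> z \<notin> approx_box s t \<epsilon> q p r"
  shows "z \<in> Bad s t"
proof (rule ccontr)
  assume bad: "z \<notin> Bad s t"
  let ?f = "\<lambda>q::nat. max (real q powr s * dist_int (real q * fst z)) (real q powr t * dist_int (real q * snd z))"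
  have "(INF q\<in>{q. q > 0}. ?f q) < \<epsilon>" using bad \<open>\<epsilon> > 0\<close> by (auto simp: Bad_def case_prod_beta)
  moreover have "bdd_below (?f ` {q. q > 0})"
    by (intro bdd_belowI2[where m = 0]) (simp add: dist_int_def infdist_nonneg le_max_iff_disj)
  ultimately obtain q :: nat where q: "q > 0" "?f q < \<epsilon>" by (subst (asm) cINF_less_iff) auto
  obtain p r :: int where "dist_int (real q * fst z) = \<bar>real q * fst z - p\<bar>"
    "dist_int (real q * snd z) = \<bar>real q * snd z - r\<bar>" using dist_int_attained by metis
  then have "z \<in> approx_box s t \<epsilon> (int q) p r" using q by (auto simp: approx_box_def)
  with no[of "int q"] q show False by simp
qed

text \<open>Between the ends of a horizontal or vertical diameter the line form changes by 2 \<rho>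
  |A| or 2 \<rho> |B|, but it is small throughout the box. A box containing a disk thus has small
  height; \<open>avoids_boxes\<close> uses this to assign it to an earlier round.\<close>

lemma disk_in_box_radius:
  assumes f: "flag s t q p r A B C" and "\<rho> \<ge> 0" and sub: "cball x \<rho> \<subseteq> approx_box s t \<epsilon> q p r"
  shows "q * coeff_norm A B * \<rho> \<le> 2 * \<epsilon>"
proof -
  have q: "q > 0" using f by (simp add: flag_def)
  have near: "q * \<bar>A * fst z + B * snd z + C\<bar> \<le> 2 * \<epsilon>" if "z \<in> cball x \<rho>" for z :: "real \<times> real"
    using f that sub by (intro line_bound[of A p B r C q s t z]) (auto simp: flag_def)
  obtain x1 x2 where x: "x = (x1, x2)" by (cases x)
  have "q * \<bar>real_of_int A\<bar> * \<rho> \<le> 2 * \<epsilon>"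
  proof -
    have "(x1 + \<rho>, x2) \<in> cball x \<rho>" "(x1 - \<rho>, x2) \<in> cball x \<rho>"
      using \<open>\<rho> \<ge> 0\<close> by (auto simp: x dist_Pair_Pair dist_real_def)
    from this[THEN near] have "q * \<bar>A * (x1 + \<rho>) + B * x2 + C\<bar> + q * \<bar>A * (x1 - \<rho>) + B * x2 + C\<bar> \<le> 4 * \<epsilon>"
      by simp
    moreover have "\<bar>real_of_int A\<bar> * (2 * \<rho>) = \<bar>(A * (x1 + \<rho>) + B * x2 + C) - (A * (x1 - \<rho>) + B * x2 + C)\<bar>"
      using \<open>\<rho> \<ge> 0\<close> by (simp add: algebra_simps abs_mult)
    then have "\<bar>real_of_int A\<bar> * (2 * \<rho>) \<le> \<bar>A * (x1 + \<rho>) + B * x2 + C\<bar> + \<bar>A * (x1 - \<rho>) + B * x2 + C\<bar>"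
      by linarith
    then have "q * (\<bar>real_of_int A\<bar> * (2 * \<rho>)) \<le> q * (\<bar>A * (x1 + \<rho>) + B * x2 + C\<bar> + \<bar>A * (x1 - \<rho>) + B * x2 + C\<bar>)"
      by (rule mult_left_mono) (use q in simp)
    ultimately show ?thesis by (simp add: distrib_left)
  qed
  moreover have "q * \<bar>real_of_int B\<bar> * \<rho> \<le> 2 * \<epsilon>"
  proof -
    have "(x1, x2 + \<rho>) \<in> cball x \<rho>" "(x1, x2 - \<rho>) \<in> cball x \<rho>"
      using \<open>\<rho> \<ge> 0\<close> by (auto simp: x dist_Pair_Pair dist_real_def)
    from this[THEN near] have "q * \<bar>A * x1 + B * (x2 + \<rho>) + C\<bar> + q * \<bar>A * x1 + B * (x2 - \<rho>) + C\<bar> \<le> 4 * \<epsilon>"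
      by simp
    moreover have "\<bar>real_of_int B\<bar> * (2 * \<rho>) = \<bar>(A * x1 + B * (x2 + \<rho>) + C) - (A * x1 + B * (x2 - \<rho>) + C)\<bar>"
      using \<open>\<rho> \<ge> 0\<close> by (simp add: algebra_simps abs_mult)
    then have "\<bar>real_of_int B\<bar> * (2 * \<rho>) \<le> \<bar>A * x1 + B * (x2 + \<rho>) + C\<bar> + \<bar>A * x1 + B * (x2 - \<rho>) + C\<bar>"
      by linarith
    then have "q * (\<bar>real_of_int B\<bar> * (2 * \<rho>)) \<le> q * (\<bar>A * x1 + B * (x2 + \<rho>) + C\<bar> + \<bar>A * x1 + B * (x2 - \<rho>) + C\<bar>)"
      by (rule mult_left_mono) (use q in simp)
    ultimately show ?thesis by (simp add: distrib_left)
  qed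
  ultimately show ?thesis by (simp add: coeff_norm_def max_def)
qed

text \<open>The constants of the proof: \<open>level\<close> delimits the classes of square roots of slacks, \<open>base_scale\<close> is the
  product \<open>h \<rho>\<close> of the height scale and the radius of Bob's disk, and \<open>tolerance\<close> makes the half-width
  \<open>2 \<epsilon> / h\<close> of a strip equal to the value \<open>\<rho> / R\<^sup>m\<^sup>+\<^sup>k\<^sup>+\<^sup>1\<^sup>6\<close> required by the game. Here \<open>\<rho>\<close> is the radius of Bob's
  first disk.\<close>

definition level :: "real \<Rightarrow> nat \<Rightarrow> real" where
  "level R k = (if k = 0 then 1 else 48 * R ^ (26 + k))"

section \<open>Estimates for the constants\<close>

lemma power_le_level:
  assumes "R \<ge> 1"
  shows "R ^ k \<le> level R k"
proof -
  have "R ^ k \<le> R ^ (26 + k)" using assms by (intro power_increasing) auto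
  moreover have "0 \<le> R ^ (26 + k)" using assms by simp
  ultimately have "R ^ k \<le> 48 * R ^ (26 + k)" by linarith
  then show ?thesis by (simp add: level_def)
qed

lemma level_ge_1: "R \<ge> 1 \<Longrightarrow> level R k \<ge> 1"
  using power_le_level[of R k] one_le_power[of R k] by linarith

lemma level_mono:
  assumes "R \<ge> 1"
  shows "level R k \<le> level R (Suc k)"
proof (cases "k = 0")
  case True
  then show ?thesis using level_ge_1[OF assms, of 1] by (simp add: level_def[of R 0])
next
  case False
  have "R ^ (26 + k) \<le> R ^ (26 + Suc k)" using assms by (intro power_increasing) auto
  then have "48 * R ^ (26 + k) \<le> 48 * R ^ (26 + Suc k)" by linarith
  then show ?thesis using False unfolding level_def by (simp only: if_False nat.distinct)
qed

definition base_scale :: "real \<Rightarrow> real \<Rightarrow> real" where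
  "base_scale R \<rho> = min (\<rho> / R) (1 / (16 * R ^ 3 * (level R 1)\<^sup>2))"

definition tolerance :: "real \<Rightarrow> real \<Rightarrow> real" where
  "tolerance R \<rho> = base_scale R \<rho> / (2 * R ^ 15)"

lemma base_scale_bounds:
  assumes "R \<ge> 1" "\<rho> > 0"
  shows "0 < base_scale R \<rho>" "base_scale R \<rho> * R \<le> \<rho>"
    "base_scale R \<rho> * (16 * R ^ 3 * (level R 1)\<^sup>2) \<le> 1" "base_scale R \<rho> \<le> 1"
    "0 < tolerance R \<rho>" "2 * tolerance R \<rho> \<le> base_scale R \<rho>"
proof -
  define X where "X = 16 * R ^ 3 * (level R 1)\<^sup>2"
  have l: "(level R 1)\<^sup>2 \<ge> 1" "R ^ 3 \<ge> 1" "R ^ 15 \<ge> 1"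
    using level_ge_1[OF assms(1), of 1] assms by (auto intro: one_le_power)
  then have "1 * 1 \<le> R ^ 3 * (level R 1)\<^sup>2" using assms by (intro mult_mono) auto
  then have X: "X \<ge> 1" unfolding X_def by linarith
  have s: "base_scale R \<rho> = min (\<rho> / R) (1 / X)" by (simp only: base_scale_def X_def)
  show pos: "0 < base_scale R \<rho>" using assms X by (simp add: s)
  have "base_scale R \<rho> \<le> \<rho> / R" by (simp add: s)
  then show "base_scale R \<rho> * R \<le> \<rho>" using assms by (simp add: field_simps)
  have "base_scale R \<rho> \<le> 1 / X" by (simp add: s)
  then have le1: "base_scale R \<rho> * X \<le> 1" using X by (simp add: field_simps)
  then show "base_scale R \<rho> * (16 * R ^ 3 * (level R 1)\<^sup>2) \<le> 1" by (simp only: X_def)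
  have "base_scale R \<rho> * 1 \<le> base_scale R \<rho> * X" using pos X by (intro mult_left_mono) auto
  with le1 show "base_scale R \<rho> \<le> 1" by simp
  show "0 < tolerance R \<rho>" using pos l(3) unfolding tolerance_def by (intro divide_pos_pos) linarith+
  have "base_scale R \<rho> / R ^ 15 \<le> base_scale R \<rho> / 1" using pos l assms by (intro divide_left_mono) auto
  then show "2 * tolerance R \<rho> \<le> base_scale R \<rho>" by (simp add: tolerance_def)
qed

text \<open>Thresholds for the height with ratio \<open>R\<close>. Times the radius \<rho> / R^m of
  the m-th disk, the threshold of index m + k + 1 is
  \<open>base_scale R \<rho> * R ^ (k + 1)\<close>, in which \<open>m\<close> no longer
  occurs.\<close>

definition height_step :: "real \<Rightarrow> real \<Rightarrow> nat \<Rightarrow> real" where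
  "height_step R \<rho> N = base_scale R \<rho> * R ^ N / \<rho>"

text \<open>Disks inside a single box get the empty set, as their boxes need not lie in one strip; in the actual
  play such a box is the business of an earlier round.\<close>

definition danger :: "real \<Rightarrow> real \<Rightarrow> real \<Rightarrow> real \<Rightarrow> nat \<Rightarrow> nat \<Rightarrow> disk \<Rightarrow> (real \<times> real) set" where
  "danger s t R \<rho> m k D =
    (if \<exists>q p r. q > 0 \<and> disk_set D \<subseteq> approx_box s t (tolerance R \<rho>) q p r then {}
     else stratum s t (tolerance R \<rho>) R (height_step R \<rho> (m + k + 1)) ((level R k)\<^sup>2) ((level R (Suc k))\<^sup>2) (disk_set D))"

lemma danger_strip:
  assumes st: "s \<ge> 0" "t \<ge> 0" "s + t = 1" and R: "R \<ge> 1" and \<rho>: "\<rho> > 0" and D: "radius D = \<rho> / R ^ m"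
  shows "strip (\<rho> / R ^ (m + k + 16)) (danger s t R \<rho> m k D)"
proof (cases "\<exists>q p r. q > 0 \<and> disk_set D \<subseteq> approx_box s t (tolerance R \<rho>) q p r")
  case True
  then show ?thesis by (simp add: danger_def strip_empty)
next
  case False
  define \<kappa> \<epsilon> h where "\<kappa> = base_scale R \<rho>" and "\<epsilon> = tolerance R \<rho>" and "h = height_step R \<rho> (m + k + 1)"
  note b = base_scale_bounds[OF R \<rho>, folded \<kappa>_def \<epsilon>_def]
  have h: "h > 0" using b R \<rho> by (simp add: h_def height_step_def \<kappa>_def)
  have rh: "radius D * h = \<kappa> * R ^ (k + 1)"
    using \<rho> R by (simp add: D h_def height_step_def \<kappa>_def power_add)
  then have rh': "4 * radius D * (R * h) = 4 * \<kappa> * R ^ (k + 2)" by simp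
  have eq: "2 * \<epsilon> / h = \<rho> / R ^ (m + k + 16)"
  proof -
    have "m + k + 16 = (m + k + 1) + 15" by simp
    then have "R ^ (m + k + 16) = R ^ (m + k + 1) * R ^ 15" by (simp only: power_add)
    then show ?thesis
      using b(1) R \<rho> unfolding h_def height_step_def \<epsilon>_def tolerance_def \<kappa>_def
      by (simp only:) (simp add: divide_simps)
  qed
  have Rp: "R ^ j \<ge> 1" for j using R by simp
  have "strip (2 * \<epsilon> / h) (stratum s t \<epsilon> R h ((level R k)\<^sup>2) ((level R (Suc k))\<^sup>2) (cball (fst D) (radius D)))"
  proof (rule stratum_strip[OF st R h _ level_ge_1[OF R] level_mono[OF R] b(5)])
    show "0 \<le> radius D" using D \<rho> R by simp
    show "\<not> (\<exists>q p r. q > 0 \<and> cball (fst D) (radius D) \<subseteq> approx_box s t \<epsilon> q p r)"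
      using False by (simp add: disk_set_def \<epsilon>_def)
    let ?L = "(level R (Suc k))\<^sup>2 / (level R k)\<^sup>2 * R" and ?c = "4 * radius D * (R * h) + 2 * \<epsilon>"
    show "level R k = 1 \<and> (level R (Suc k))\<^sup>2 * R * (4 * radius D * (R * h) + 4 * \<epsilon>) < 1 \<or>
      ?L = ?L \<and> ?c = ?c \<and> 4 * ?L ^ 3 * ?c / level R k \<le> \<epsilon> \<and> 2 * ?L * ?c / (level R k)\<^sup>2 < 1"
    proof (cases "k = 0")
      case True
      \<comment> \<open>The second entry of the minimum in \<open>base_scale\<close> is made for
        this case and leaves a factor 1/2 to spare.\<close>
      have "1 * \<epsilon> \<le> R\<^sup>2 * \<kappa>" using b by (intro mult_mono) (auto simp: R)
      then have "4 * radius D * (R * h) + 4 * \<epsilon> \<le> 8 * (R\<^sup>2 * \<kappa>)"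
        unfolding rh' True by (simp add: power2_eq_square)
      then have "(level R 1)\<^sup>2 * R * (4 * radius D * (R * h) + 4 * \<epsilon>) \<le> (level R 1)\<^sup>2 * R * (8 * (R\<^sup>2 * \<kappa>))"
        using R by (intro mult_left_mono) auto
      also have "\<dots> = \<kappa> * (16 * R ^ 3 * (level R 1)\<^sup>2) / 2" by (simp add: power2_eq_square power3_eq_cube)
      also have "\<dots> < 1" using b(3) by linarith
      finally show ?thesis using True by (simp add: level_def)
    next
      case False
      \<comment> \<open>For k > 0 consecutive levels have ratio R, so that the quotient of their
        squares, times R, is R^3.\<close>
      define G where "G = 48 * R ^ 26"
      have "R ^ (26 + Suc k) = R ^ 26 * R ^ k * R" by (simp only: power_add power_Suc ac_simps)
      then have G: "G > 0" "level R k = G * R ^ k" "level R (Suc k) = G * R ^ k * R"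
        using False R unfolding level_def G_def
        by (simp, simp add: power_add, simp only: if_False nat.distinct mult.assoc)
      have L: "?L = R ^ 3" unfolding G using G(1) R by (simp add: power_mult_distrib power2_eq_square power3_eq_cube)
      have "\<kappa> * 1 \<le> \<kappa> * R ^ (k + 2)" using b(1) by (intro mult_left_mono Rp) simp
      then have "2 * \<epsilon> \<le> \<kappa> * R ^ (k + 2)" using b(6) by linarith
      then have c: "?c \<le> 6 * \<kappa> * R ^ (k + 2)" "0 \<le> ?c"
        using rh' mult.assoc[of 4 \<kappa> "R ^ (k + 2)"] mult.assoc[of 6 \<kappa> "R ^ (k + 2)"] b(5) by linarith+
      have "4 * ?L ^ 3 * ?c / level R k \<le> 4 * ?L ^ 3 * (6 * \<kappa> * R ^ (k + 2)) / level R k"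
        unfolding L G using c R G(1) by (intro divide_right_mono mult_left_mono) auto
      \<comment> \<open>The numbers 48 and 26 in \<open>level\<close> come from here: 4 R^9 * 6
        \<kappa> R^(k+2) / (48 R^(26+k)) = \<kappa> / (2 R^15).\<close>
      also have "\<dots> = \<epsilon>"
      proof -
        have e: "R ^ (k + 2) = R ^ k * R\<^sup>2" "R ^ 26 = R ^ 15 * (R ^ 3) ^ 3 * R\<^sup>2"
          by (simp_all only: power_add flip: power_mult) (simp flip: power_add)
        have K: "4 * b * (6 * \<kappa> * (a * c)) / (48 * (d * b * c) * a) = \<kappa> / (2 * d)"
          if "a > 0" "b > 0" "c > 0" "d > 0" for a b c d :: real
          using that by (simp add: field_simps)
        show ?thesis
          unfolding L unfolding G \<epsilon>_def tolerance_def \<kappa>_def[symmetric] G_def e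
          by (rule K) (use R in simp_all)
      qed
      finally have 1: "4 * ?L ^ 3 * ?c / level R k \<le> \<epsilon>" .
      have "2 * ?L * ?c / (level R k)\<^sup>2 \<le> 2 * ?L * (6 * \<kappa> * R ^ (k + 2)) / (level R k)\<^sup>2"
        unfolding L G using c R G(1) by (intro divide_right_mono mult_left_mono) auto
      also have "\<dots> = 12 * \<kappa> * R ^ (k + 5) / (level R k)\<^sup>2" 
      proof -
        have "k + 5 = 3 + (k + 2)" by simp
        then have e: "R ^ (k + 5) = R ^ 3 * R ^ (k + 2)" by (simp only: power_add)
        have "2 * a * (6 * \<kappa> * b) = 12 * \<kappa> * (a * b)" for a b by simp
        then show ?thesis unfolding L e by (simp only:)
      qed
      also have "\<dots> < 1"
      proof -
        have "12 * \<kappa> * R ^ (k + 5) \<le> 12 * 1 * R ^ (k + 5)" using b R by (intro mult_right_mono mult_left_mono) auto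
        also have "\<dots> < 48\<^sup>2 * R ^ (52 + 2 * k)"
        proof -
          have K: "12 * 1 * a < 48\<^sup>2 * b" if "a \<le> b" "1 \<le> b" for a b :: real using that by simp
          show ?thesis by (intro K power_increasing Rp) (use R in simp_all)
        qed
        also have "\<dots> = (level R k)\<^sup>2"
        proof -
          have "52 + 2 * k = 26 + 26 + (k + k)" by simp
          then have e: "R ^ (52 + 2 * k) = R ^ 26 * R ^ 26 * (R ^ k * R ^ k)" by (simp only: power_add)
          show ?thesis unfolding G G_def e power2_eq_square by (simp only: ac_simps)
        qed
        finally show ?thesis using G R by simp
      qed
      finally have 2: "2 * ?L * ?c / (level R k)\<^sup>2 < 1" .
      from 1 2 show ?thesis by blast
    qed
  qed
  then have "strip (\<rho> / R ^ (m + k + 16)) (stratum s t \<epsilon> R h ((level R k)\<^sup>2) ((level R (Suc k))\<^sup>2) (disk_set D))"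
    by (simp only: eq disk_set_def)
  then show ?thesis unfolding danger_def if_not_P[OF False] \<epsilon>_def h_def .
qed

text \<open>Height and slack are at least 1 and both sequences of thresholds start at or below 1 and
  are unbounded, so each value lies between two consecutive thresholds.\<close>

lemma flag_graded:
  assumes st: "s \<ge> 0" "t \<ge> 0" "s + t = 1" and R: "R \<ge> 2" and \<rho>: "\<rho> > 0" and f: "flag s t q p r A B C"
  shows "\<exists>m k. graded s t R (height_step R \<rho> (m + k + 1)) ((level R k)\<^sup>2) ((level R (Suc k))\<^sup>2) q A B"
proof -
  define \<kappa> where "\<kappa> = base_scale R \<rho>"
  have R1: "R \<ge> 1" using R by simp
  note b = base_scale_bounds[OF R1 \<rho>, folded \<kappa>_def]
  define M where "M = coeff_norm A B"
  have M: "M \<ge> 1" using f unfolding M_def by (intro coeff_norm_ge_1) (auto simp: flag_def)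
  have q: "real_of_int q \<ge> 1" using f by (auto simp: flag_def)
  have qM: "1 \<le> q * M" "real_of_int q \<le> q * M" using mult_mono[OF q M] mult_left_mono[OF M, of q] q by auto
  have unbounded: "\<exists>n. x < c * R ^ n" if "c > 0" for x c
    using real_arch_pow[of R "x / c"] R that by (auto simp: field_simps)
  have "\<exists>N. height_step R \<rho> (Suc N) \<le> q * M \<and> q * M < height_step R \<rho> (Suc (Suc N))"
  proof -
    obtain n where "q * M < (\<kappa> * R / \<rho>) * R ^ n" using unbounded[of "\<kappa> * R / \<rho>"] b R \<rho> by auto
    then have "q * M < height_step R \<rho> (Suc n)" by (simp add: height_step_def \<kappa>_def)
    moreover have "height_step R \<rho> (Suc 0) \<le> 1" using b(2) \<rho> by (simp add: height_step_def \<kappa>_def)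
    then have "height_step R \<rho> (Suc 0) \<le> q * M" using qM by linarith
    ultimately show ?thesis by (intro ex_crossing[of "\<lambda>n. height_step R \<rho> (Suc n)"])
  qed
  then obtain N where N: "height_step R \<rho> (Suc N) \<le> q * M" "q * M < height_step R \<rho> (Suc (Suc N))" by blast
  have s1: "s \<le> max s t" "t \<le> max s t" "max s t \<le> 1" using st by auto
  have Mq: "M \<le> q powr max s t"
    using f powr_mono[OF s1(1) q] powr_mono[OF s1(2) q] by (auto simp: M_def coeff_norm_def flag_def)
  have "\<exists>k. (level R k)\<^sup>2 * M \<le> q powr max s t \<and> q powr max s t < (level R (Suc k))\<^sup>2 * M"
  proof -
    obtain n where n: "q powr max s t < 1 * R ^ n" using unbounded[of 1] by auto
    have "R ^ n \<le> R ^ Suc n" using R by (intro power_increasing) auto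
    then have "R ^ n \<le> level R (Suc n)" using power_le_level[OF R1, of "Suc n"] by linarith
    also have "\<dots> * 1 \<le> level R (Suc n) * level R (Suc n)"
      using level_ge_1[OF R1, of "Suc n"] by (intro mult_left_mono) auto
    finally have "R ^ n * 1 \<le> (level R (Suc n))\<^sup>2 * M"
      using M by (intro mult_mono) (auto simp: power2_eq_square)
    with n have "q powr max s t < (level R (Suc n))\<^sup>2 * M" by simp
    moreover have "(level R 0)\<^sup>2 * M \<le> q powr max s t" using Mq by (simp add: level_def)
    ultimately show ?thesis by (intro ex_crossing[of "\<lambda>k. (level R k)\<^sup>2 * M"])
  qed
  then obtain k where k: "(level R k)\<^sup>2 * M \<le> q powr max s t" "q powr max s t < (level R (Suc k))\<^sup>2 * M" by blast
  \<comment> \<open>The round is N - k, which must not be truncated: the slack is at most q, hence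
    at most the height, which is below R^(N+1).\<close>
  have "k \<le> N"
  proof (cases "k = 0")
    case False
    have "R ^ k \<le> level R k" using power_le_level[OF R1] .
    moreover have "level R k * 1 \<le> level R k * level R k" "0 \<le> (level R k)\<^sup>2"
      using level_ge_1[OF R1, of k] by (auto intro: mult_left_mono)
    ultimately have "R ^ k * 1 \<le> (level R k)\<^sup>2 * M" using M by (intro mult_mono) (auto simp: power2_eq_square)
    also have "\<dots> \<le> q powr 1" using k(1) powr_mono[OF s1(3) q] by linarith
    also have "\<dots> \<le> q * M" using qM q by simp
    also have "\<dots> < height_step R \<rho> (Suc (Suc N))" by fact
    also have "\<dots> = (\<kappa> * R) * R ^ Suc N / \<rho>" by (simp add: height_step_def \<kappa>_def)
    also have "\<dots> \<le> \<rho> * R ^ Suc N / \<rho>" using b(2) R \<rho> by (intro divide_right_mono mult_right_mono) auto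
    finally have "R ^ k < R ^ Suc N" using \<rho> by simp
    then have "k < Suc N" by (rule power_less_imp_less_exp[rotated]) (use R in simp)
    then show ?thesis by simp
  qed simp
  then have "Suc N = (N - k) + k + 1" by simp
  moreover have "graded s t R (height_step R \<rho> (Suc N)) ((level R k)\<^sup>2) ((level R (Suc k))\<^sup>2) q A B"
    using N k unfolding graded_def by (simp add: M_def height_step_def algebra_simps)
  ultimately show ?thesis by metis
qed

text \<open>Strong induction on the round \<open>m\<close> of a box containing \<open>z\<close>.
  Either the disk \<open>B m\<close> lies in no single box, and then \<open>z\<close> is in the
  \<open>danger\<close> set of that round; or it lies in one, which contains \<open>z\<close> too
  and has a smaller round by \<open>disk_in_box_radius\<close>.\<close>

lemma avoids_boxes:
  assumes st: "s \<ge> 0" "t \<ge> 0" "s + t = 1" and R: "R \<ge> 2" and \<rho>: "\<rho> > 0"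
    and B: "\<And>n. radius (B n) = \<rho> / R ^ n" and z: "\<And>n. z \<in> disk_set (B n)"
    and avoid: "\<And>m k. z \<notin> danger s t R \<rho> m k (B m)" and "q > 0"
  shows "z \<notin> approx_box s t (tolerance R \<rho>) q p r"
proof -
  define \<epsilon> where "\<epsilon> = tolerance R \<rho>"
  have R1: "R \<ge> 1" using R by simp
  note b = base_scale_bounds[OF R1 \<rho>]
  have *: False if "flag s t q p r a b' c"
      "graded s t R (height_step R \<rho> (m + k + 1)) ((level R k)\<^sup>2) ((level R (Suc k))\<^sup>2) q a b'"
      "z \<in> approx_box s t \<epsilon> q p r" for m k q p r a b' c
    using that
  proof (induction m arbitrary: k q p r a b' c rule: less_induct)
    case (less m)
    show False
    proof (cases "\<exists>q p r. q > 0 \<and> disk_set (B m) \<subseteq> approx_box s t \<epsilon> q p r")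
      case False
      then have "danger s t R \<rho> m k (B m) =
        stratum s t \<epsilon> R (height_step R \<rho> (m + k + 1)) ((level R k)\<^sup>2) ((level R (Suc k))\<^sup>2) (disk_set (B m))"
        unfolding danger_def \<epsilon>_def by (rule if_not_P)
      moreover have "z \<in> \<dots>" using less.prems z[of m] unfolding stratum_def by blast
      ultimately show False using avoid by blast
    next
      case True
      then obtain q0 p0 r0 where q0: "q0 > 0" and sub: "disk_set (B m) \<subseteq> approx_box s t \<epsilon> q0 p0 r0" by blast
      obtain a0 b0 c0 where f0: "flag s t q0 p0 r0 a0 b0 c0" using flag_exists[OF q0 st(3)] by blast
      obtain m0 k0 where g0: "graded s t R (height_step R \<rho> (m0 + k0 + 1)) ((level R k0)\<^sup>2) ((level R (Suc k0))\<^sup>2) q0 a0 b0"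
        using flag_graded[OF st R \<rho> f0] by blast
      have "height_step R \<rho> (m0 + k0 + 1) * (\<rho> / R ^ m) \<le> q0 * coeff_norm a0 b0 * (\<rho> / R ^ m)"
        using g0 R \<rho> by (intro mult_right_mono) (auto simp: graded_def)
      also have "\<dots> \<le> 2 * \<epsilon>"
        using disk_in_box_radius[OF f0 _ sub[unfolded disk_set_def]] B[of m] R \<rho> by simp
      also have "\<dots> \<le> base_scale R \<rho>" using b(6) by (simp add: \<epsilon>_def)
      finally have "R ^ (m0 + k0 + 1) \<le> R ^ m"
        using b(1) R \<rho> by (simp add: height_step_def field_simps)
      then have "m0 + k0 + 1 \<le> m" by (rule power_le_imp_le_exp[rotated]) (use R in simp)
      then have "m0 < m" by simp
      from less.IH[OF this f0 g0] sub z[of m] show False by blast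
    qed
  qed
  show ?thesis
  proof
    assume "z \<in> approx_box s t (tolerance R \<rho>) q p r"
    moreover obtain a b' c where "flag s t q p r a b' c" using flag_exists[OF \<open>q > 0\<close> st(3)] by blast
    moreover from flag_graded[OF st R \<rho> this] obtain m k where
      "graded s t R (height_step R \<rho> (m + k + 1)) ((level R k)\<^sup>2) ((level R (Suc k))\<^sup>2) q a b'" by blast
    ultimately show False using * by (simp add: \<epsilon>_def)
  qed
qed

theorem theorem1p1:
  fixes s t :: real
  assumes "s \<ge> 0" and "t \<ge> 0" and "s + t = 1"
  shows "winning (inverse (24 * sqrt 2)) (Bad s t)"
  unfolding winning_def
proof
  fix \<beta> :: real assume \<beta>: "\<beta> \<in> {0<..<1}"
  define \<alpha> :: real where "\<alpha> = inverse (24 * sqrt 2)"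
  \<comment> \<open>This makes 24 sqrt 2 >= 32; the game argument only asks for 0 < \<alpha> <=
    1/32.\<close>
  have "4/3 \<le> sqrt (2::real)" by (rule real_le_rsqrt) (simp add: power2_eq_square)
  then have \<alpha>: "0 < \<alpha>" "\<alpha> \<le> 1/32" by (auto simp: \<alpha>_def field_simps)
  define R where "R = 1 / (\<alpha> * \<beta>)"
  have "\<alpha> * \<beta> \<le> 1/32 * 1" using \<alpha> \<beta> by (intro mult_mono) auto
  then have R: "R \<ge> 2" using \<alpha> \<beta> unfolding R_def by (simp add: field_simps)
  have "game_winning \<alpha> \<beta> (Bad s t)"
  proof (rule game_winning_by_strips[OF \<alpha> _ _ R_def])
    show "strip (\<rho> / R ^ (m + k + 16)) (danger s t R \<rho> m k D)" if "\<rho> > 0" "radius D = \<rho> / R ^ m" for \<rho> m k D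
      by (rule danger_strip[OF assms _ that]) (use R in linarith)
    show "z \<in> Bad s t" if "radius (B 0) > 0" "\<And>n. radius (B n) = radius (B 0) / R ^ n"
      "\<And>n. z \<in> disk_set (B n)" "\<And>m k. z \<notin> danger s t R (radius (B 0)) m k (B m)" for B z
    proof (rule Bad_if_avoids_boxes)
      show "0 < tolerance R (radius (B 0))" by (rule base_scale_bounds(5)[OF _ that(1)]) (use R in linarith)
      show "z \<notin> approx_box s t (tolerance R (radius (B 0))) q p r" if "q > 0" for q p r
        by (rule avoids_boxes[where B = B, OF assms R]) fact+
    qed
  qed (use \<beta> in auto)
  then show "game_winning (inverse (24 * sqrt 2)) \<beta> (Bad s t)" by (simp add: \<alpha>_def)
qed

end
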